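(* Let $\mathfrak{g}=\mathfrak{sl}_3(\mathbf{R})$ and let $\mathfrak{g}\to\mathrm{End}(W)$ be a faithful finite dimensional real representation such that there is a symmetric bilinear $\mathfrak{g}$-equivariant map $\wedge:W\times W\to W^*$ which does not vanish identically on any $2$-dimensional linear subspace of $W$. Then there exist integers $k\geq 0$ and $m\geq 0$ such that $W$ is isomorphic to $\mathrm{Sym}_2(E^* )\oplus E^k\oplus T^m$ or to its dual $\mathrm{Sym}_2(E)\oplus (E^* )^k\oplus T^m$.
   Context: $E=\mathbf{R}^3$ is the standard representation of $\mathfrak{sl}_3(\mathbf{R})$, $E^*$ its dual, $\mathrm{Sym}_2(E^* )$ the representation on quadratic forms on $E$, $T$ the trivial one-dimensional representation, and $V^k$ denotes the direct sum of $k$ copies of $V$. $W^*$ is the dual of $W$; equivariance of $\wedge$ means $X\cdot(a\wedge b)=(X\cdot a)\wedge b+a\wedge(X\cdot b)$. *)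

theory Defs
  imports "HOL-Analysis.Analysis"
begin

definition sl3 :: "(real^3^3) set" where
  "sl3 = {X. trace X = 0}"

definition sl3_rep :: "(real^3^3 \<Rightarrow> real^'n^'n) \<Rightarrow> bool" where
  "sl3_rep rho \<longleftrightarrow>
     (\<forall>X\<in>sl3. \<forall>Y\<in>sl3. \<forall>a b::real. rho (a *\<^sub>R X + b *\<^sub>R Y) = a *\<^sub>R rho X + b *\<^sub>R rho Y) \<and>
     (\<forall>X\<in>sl3. \<forall>Y\<in>sl3. rho (X ** Y - Y ** X) = rho X ** rho Y - rho Y ** rho X)"

definition faithful :: "(real^3^3 \<Rightarrow> real^'n^'n) \<Rightarrow> bool" where
  "faithful rho \<longleftrightarrow> (\<forall>X\<in>sl3. \<forall>Y\<in>sl3. rho X = rho Y \<longrightarrow> X = Y)"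

text \<open>A symmetric bilinear map W x W -> W^*, elements of W^* being linear functionals on W.
  The dual action is (X.f)(c) = - f(X.c).\<close>
definition equivariant_wedge ::
  "(real^3^3 \<Rightarrow> real^'n^'n) \<Rightarrow> (real^'n \<Rightarrow> real^'n \<Rightarrow> (real^'n \<Rightarrow> real)) \<Rightarrow> bool" where
  "equivariant_wedge rho w \<longleftrightarrow>
     (\<forall>b c. linear (\<lambda>a. w a b c)) \<and>
     (\<forall>a c. linear (\<lambda>b. w a b c)) \<and>
     (\<forall>a b. linear (w a b)) \<and>
     (\<forall>a b. w a b = w b a) \<and>
     (\<forall>X\<in>sl3. \<forall>a b c. - w a b (rho X *v c) = w (rho X *v a) b c + w a (rho X *v b) c)"

text \<open>Model spaces Sym_2(E^*) + E^k + T^m. A quadratic form on E is stored as a symmetric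
  matrix S (Q(v) = v . (S v)); E^k as a sequence of k vectors, T^m as a sequence of m reals.\<close>
type_synonym model = "(real^3^3) \<times> (nat \<Rightarrow> real^3) \<times> (nat \<Rightarrow> real)"

definition model_carrier :: "nat \<Rightarrow> nat \<Rightarrow> model set" where
  "model_carrier k m = {(S, v, t). transpose S = S \<and> (\<forall>i\<ge>k. v i = 0) \<and> (\<forall>j\<ge>m. t j = 0)}"

definition model_act :: "real^3^3 \<Rightarrow> model \<Rightarrow> model" where
  "model_act X x = (case x of (S, v, t) \<Rightarrow>
      (- (transpose X ** S + S ** X), (\<lambda>i. X *v v i), (\<lambda>j. 0)))"

text \<open>Action on the dual Sym_2(E) + (E^*)^k + T^m (symmetric tensors S, covectors).\<close>
definition dual_model_act :: "real^3^3 \<Rightarrow> model \<Rightarrow> model" where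
  "dual_model_act X x = (case x of (S, v, t) \<Rightarrow>
      (X ** S + S ** transpose X, (\<lambda>i. - (transpose X *v v i)), (\<lambda>j. 0)))"

definition linear_to_model :: "(real^'n \<Rightarrow> model) \<Rightarrow> bool" where
  "linear_to_model phi \<longleftrightarrow>
     linear (\<lambda>w. fst (phi w)) \<and>
     (\<forall>i. linear (\<lambda>w. fst (snd (phi w)) i)) \<and>
     (\<forall>j. linear (\<lambda>w. snd (snd (phi w)) j))"

definition rep_iso ::
  "(real^3^3 \<Rightarrow> real^'n^'n) \<Rightarrow> (real^3^3 \<Rightarrow> model \<Rightarrow> model) \<Rightarrow> model set \<Rightarrow> bool" where
  "rep_iso rho act M \<longleftrightarrow>
     (\<exists>phi::real^'n \<Rightarrow> model. linear_to_model phi \<and> inj phi \<and> phi ` UNIV = M \<and>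
        (\<forall>X\<in>sl3. \<forall>w. phi (rho X *v w) = act X (phi w)))"

end

theory Submission
  imports Defs
begin

text \<open>
  Weights are vectors \<open>x\<close> of the plane \<open>x\<^sub>1 + x\<^sub>2 + x\<^sub>3 = 0\<close>: on a vector of weight \<open>x\<close>, the matrix
  \<open>diag t\<close> acts by \<open>x \<bullet> t\<close>. Equivariance pairs weights \<open>x, y\<close> only with the weight \<open>- x - y\<close>. If none of
  \<open>-2x\<close>, \<open>-2y\<close>, \<open>- x - y\<close> is a weight, then two independent vectors of weights \<open>x\<close> and \<open>y\<close> span an isotropic
  plane, which is forbidden. Applied to a longest weight, its reflections and its neighbours, this forces
  the longest weights to be the \<open>-2\<epsilon>\<^sub>a\<close> (or all the \<open>2\<epsilon>\<^sub>a\<close>, the dual case), with multiplicity one, and all other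
  weights to be \<open>0\<close> or some \<open>\<epsilon>\<^sub>a\<close>. The dual case reduces to the first one by composing the representation
  with the automorphism \<open>X \<mapsto> - X\<^sup>T\<close>.

  With so few weights, complete reducibility is elementary: a vector of weight \<open>-2\<epsilon>\<^sub>1\<close> generates \<open>Sym\<^sub>2(E\<^sup>*)\<close>,
  the vectors of weight \<open>\<epsilon>\<^sub>1\<close> killed by \<open>E\<^sub>2\<^sub>3\<close> and \<open>E\<^sub>3\<^sub>2\<close> generate copies of \<open>E\<close>, and the zero weight
  space is trivial.
\<close>


section \<open>Integral diagonalizability for \<open>sl\<^sub>2\<close>\<close>

text \<open>Applying \<open>T - t\<close> removes the component of eigenvalue \<open>t\<close> and
  multiplies every other one by a nonzero factor \<open>s - t\<close>, so induction on the set of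
  eigenvalues works.\<close>

lemma eigencomponents_in_invariant_subspace:
  fixes T :: "'a::real_vector \<Rightarrow> 'a"
  assumes T: "linear T" and "finite S" and U: "subspace U" "\<And>u. u \<in> U \<Longrightarrow> T u \<in> U"
    and "\<And>s. s \<in> S \<Longrightarrow> T (v s) = s *\<^sub>R v s" and "(\<Sum>s\<in>S. v s) \<in> U"
  shows "\<forall>s\<in>S. v s \<in> U"
  using assms(2,5,6)
proof (induction S arbitrary: v rule: finite_induct)
  case empty
  then show ?case by simp
next
  case (insert t S)
  have "T (\<Sum>s\<in>insert t S. v s) = (\<Sum>s\<in>insert t S. s *\<^sub>R v s)"
    using insert.prems(1) by (simp add: linear_sum[OF T])
  then have "(\<Sum>s\<in>insert t S. (s - t) *\<^sub>R v s) = T (\<Sum>s\<in>insert t S. v s) - t *\<^sub>R (\<Sum>s\<in>insert t S. v s)"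
    by (simp add: scaleR_right.sum algebra_simps sum_subtractf)
  also have "\<dots> \<in> U"
    using U insert.prems(2) by (intro subspace_diff subspace_scale)
  finally have "(\<Sum>s\<in>S. (s - t) *\<^sub>R v s) \<in> U"
    using insert.hyps by simp
  then have "\<forall>s\<in>S. (s - t) *\<^sub>R v s \<in> U"
    using insert.prems(1) by (intro insert.IH) (auto simp: linear_scale[OF T])
  then have vS: "v s \<in> U" if "s \<in> S" for s
    using subspace_scale[OF U(1), of "(s - t) *\<^sub>R v s" "1 / (s - t)"] that insert.hyps
    by (cases "s = t") auto
  have "(\<Sum>s\<in>insert t S. v s) - (\<Sum>s\<in>S. v s) \<in> U"
    by (intro subspace_diff[OF U(1) insert.prems(2)] subspace_sum[OF U(1)] vS)
  then have "v t \<in> U" using insert.hyps by simp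
  with vS show ?case by simp
qed

lemma eigencomponents_zero:
  fixes T :: "'a::real_vector \<Rightarrow> 'a"
  assumes "linear T" "finite S" "\<And>s. s \<in> S \<Longrightarrow> T (v s) = s *\<^sub>R v s" "(\<Sum>s\<in>S. v s) = 0" "s \<in> S"
  shows "v s = 0"
  using eigencomponents_in_invariant_subspace[OF assms(1,2), of "{0}" v] assms
  by (auto simp: linear_0)

lemma finite_eigenvalues:
  fixes T :: "'a::euclidean_space \<Rightarrow> 'a"
  assumes T: "linear T"
  shows "finite {c. \<exists>v. v \<noteq> 0 \<and> T v = c *\<^sub>R v}" (is "finite ?C")
proof -
  obtain v where v: "\<And>c. c \<in> ?C \<Longrightarrow> v c \<noteq> 0 \<and> T (v c) = c *\<^sub>R v c"
    using bchoice[of ?C "\<lambda>c v. v \<noteq> 0 \<and> T v = c *\<^sub>R v"] by auto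
  have inj: "inj_on v ?C"
  proof (rule inj_onI)
    fix c d assume "c \<in> ?C" "d \<in> ?C" "v c = v d"
    then have "c *\<^sub>R v c = d *\<^sub>R v c" "v c \<noteq> 0" using v[of c] v[of d] by metis+
    then show "c = d" by simp
  qed
  have "independent (v ` ?C)"
    unfolding independent_explicit_module
  proof (intro allI impI)
    fix B u x assume B: "finite B" "B \<subseteq> v ` ?C" "(\<Sum>x\<in>B. u x *\<^sub>R x) = 0" "x \<in> B"
    obtain S where S: "S \<subseteq> ?C" "B = v ` S" using B(2) by (auto simp: subset_image_iff)
    have injS: "inj_on v S" using inj S(1) by (rule inj_on_subset)
    have fS: "finite S" using B(1) S(2) injS finite_image_iff by auto
    obtain s where s: "s \<in> S" "x = v s" using B(4) S by auto
    have "u (v s) *\<^sub>R v s = 0"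
    proof (rule eigencomponents_zero[OF T fS _ _ s(1), where v = "\<lambda>s. u (v s) *\<^sub>R v s"])
      show "T (u (v s) *\<^sub>R v s) = s *\<^sub>R u (v s) *\<^sub>R v s" if "s \<in> S" for s
        using v[OF subsetD[OF S(1) that]] by (simp add: linear_scale[OF T])
      show "(\<Sum>s\<in>S. u (v s) *\<^sub>R v s) = 0"
        using B(3) by (simp add: S(2) sum.reindex[OF injS])
    qed
    then show "u x = 0" using v[of s] s S(1) by auto
  qed
  then have "finite (v ` ?C)" by (rule independent_imp_finite)
  then show ?thesis using inj finite_image_iff by blast
qed

text \<open>With \<open>K = \<int>\<close>, the equation \<open>eigenspan T K = UNIV\<close> says
  that \<open>T\<close> is diagonalizable with integral eigenvalues.\<close>

definition eigenspan :: "('a::real_vector \<Rightarrow> 'a) \<Rightarrow> real set \<Rightarrow> 'a set" where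
  "eigenspan T K = span {v. \<exists>k\<in>K. T v = k *\<^sub>R v}"

lemma subspace_eigenspan: "subspace (eigenspan T K)"
  by (simp add: eigenspan_def)

lemma eigenvector_in_eigenspan: "T v = k *\<^sub>R v \<Longrightarrow> k \<in> K \<Longrightarrow> v \<in> eigenspan T K"
  unfolding eigenspan_def by (rule span_base) auto

lemma eigenspan_decomposition:
  assumes T: "linear T" and v: "v \<in> eigenspan T K"
  obtains S c where "finite S" "S \<subseteq> K" "\<And>s. T (c s) = s *\<^sub>R c s" "v = (\<Sum>s\<in>S. c s)"
proof -
  \<comment> \<open>The induction also keeps \<open>c\<close> zero outside \<open>S\<close>, so that
    an eigenvalue \<open>k\<close> can be inserted into \<open>S\<close> without changing the
    sum.\<close>
  have "\<exists>S c. finite S \<and> S \<subseteq> K \<and> (\<forall>s. T (c s) = s *\<^sub>R c s) \<and> (\<forall>s. s \<notin> S \<longrightarrow> c s = 0) \<and> v = (\<Sum>s\<in>S. c s)"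
    using v unfolding eigenspan_def
  proof (induction rule: span_induct_alt)
    case base
    show ?case by (rule exI[of _ "{}"], rule exI[of _ "\<lambda>_. 0"]) (simp add: linear_0[OF T])
  next
    case (step a x y)
    then obtain S c k where *: "finite S" "S \<subseteq> K" "\<And>s. T (c s) = s *\<^sub>R c s"
      "\<And>s. s \<notin> S \<Longrightarrow> c s = 0" "y = (\<Sum>s\<in>S. c s)" "k \<in> K" "T x = k *\<^sub>R x" by auto
    let ?c = "\<lambda>s. c s + (if s = k then a *\<^sub>R x else 0)"
    have "(\<Sum>s\<in>insert k S. ?c s) = (\<Sum>s\<in>insert k S. c s) + a *\<^sub>R x"
      using *(1) by (simp add: sum.distrib)
    also have "(\<Sum>s\<in>insert k S. c s) = y"
      using *(1,4,5) by (cases "k \<in> S") (auto simp: insert_absorb)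
    finally have "a *\<^sub>R x + y = (\<Sum>s\<in>insert k S. ?c s)" by simp
    moreover have "T (?c s) = s *\<^sub>R ?c s" for s
      using *(3)[of s] *(7) by (auto simp: linear_add[OF T] linear_scale[OF T] linear_0[OF T] algebra_simps)
    ultimately show ?case
      using *(1,2,4,6) by (intro exI[of _ "insert k S"] exI[of _ ?c]) auto
  qed
  then show thesis using that by blast
qed

text \<open>On eigenspaces with \<open>s \<noteq> c\<close> the operator \<open>T - c\<close> is
  invertible, so \<open>z\<close> can absorb every component of \<open>T x - c x\<close> except the
  one of eigenvalue \<open>c\<close>. What remains, \<open>x - z\<close>, is annihilated by the
  square of \<open>T - c\<close>.\<close>

lemma eigenspan_eliminate:
  assumes T: "linear T" and x: "T x - c *\<^sub>R x \<in> eigenspan T K"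
  obtains z where "z \<in> eigenspan T K"
    and "T (T (x - z) - c *\<^sub>R (x - z)) = c *\<^sub>R (T (x - z) - c *\<^sub>R (x - z))"
    and "c \<notin> K \<Longrightarrow> T (x - z) = c *\<^sub>R (x - z)"
proof -
  obtain S d where S: "finite S" "S \<subseteq> K" "\<And>s. T (d s) = s *\<^sub>R d s" "T x - c *\<^sub>R x = (\<Sum>s\<in>S. d s)"
    using eigenspan_decomposition[OF T x] by metis
  define z where "z = (\<Sum>s\<in>S - {c}. (1 / (s - c)) *\<^sub>R d s)"
  have "z \<in> eigenspan T K"
    unfolding z_def using S(2,3)
    by (intro subspace_sum subspace_scale subspace_eigenspan) (auto intro: eigenvector_in_eigenspan)
  moreover have "T z - c *\<^sub>R z = (\<Sum>s\<in>S - {c}. (s - c) *\<^sub>R (1 / (s - c)) *\<^sub>R d s)"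
    unfolding z_def scaleR_left_diff_distrib sum_subtractf
    by (simp add: linear_sum[OF T] linear_scale[OF T] S(3) scaleR_right.sum mult.commute)
  then have "T z - c *\<^sub>R z = (\<Sum>s\<in>S - {c}. d s)" by simp
  then have "T (x - z) - c *\<^sub>R (x - z) = (\<Sum>s\<in>S. d s) - (\<Sum>s\<in>S - {c}. d s)"
    using S(4) by (simp add: linear_diff[OF T] algebra_simps)
  then have eq: "T (x - z) - c *\<^sub>R (x - z) = (if c \<in> S then d c else 0)"
    using S(1) by (simp add: sum_diff1)
  moreover have "T (x - z) = c *\<^sub>R (x - z)" if "c \<notin> K"
    using eq that S(2) by (metis eq_iff_diff_eq_0 subsetD)
  ultimately show thesis
    by (intro that) (simp_all add: eq S(3) linear_0[OF T])
qed

section \<open>Finite-dimensional modules over sl_2\<close>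

lemma linear_funpow: "linear f \<Longrightarrow> linear (f ^^ n)" for f :: "'a::real_vector \<Rightarrow> 'a"
proof (induction n)
  case 0
  then show ?case using linear_id by (simp add: id_def)
next
  case (Suc n)
  then show ?case using linear_compose[of "f ^^ n" f] by (simp add: comp_def)
qed

text \<open>Nilpotency of \<open>e\<close> and \<open>f\<close> is automatic in finite dimension. It is assumed because the proof uses
  eigenvalues of \<open>ad h\<close>, for which the operators have to be matrices.\<close>
locale sl2_module =
  fixes e f h :: "'a::euclidean_space \<Rightarrow> 'a"
  assumes lin: "linear e" "linear f" "linear h"
    and he: "h (e v) = e (h v) + 2 *\<^sub>R e v"
    and hf: "h (f v) = f (h v) - 2 *\<^sub>R f v"
    and ef: "e (f v) = f (e v) + h v"
    and nilp: "\<exists>n. \<forall>v. (e ^^ n) v = 0" "\<exists>n. \<forall>v. (f ^^ n) v = 0"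
begin

lemmas lin_simps = linear_add[OF lin(1)] linear_add[OF lin(2)] linear_add[OF lin(3)]
  linear_diff[OF lin(1)] linear_diff[OF lin(2)] linear_diff[OF lin(3)]
  linear_scale[OF lin(1)] linear_scale[OF lin(2)] linear_scale[OF lin(3)]
  linear_0[OF lin(1)] linear_0[OF lin(2)] linear_0[OF lin(3)]

lemmas pow_simps = linear_add[OF linear_funpow[OF lin(1)]] linear_add[OF linear_funpow[OF lin(2)]]
  linear_diff[OF linear_funpow[OF lin(1)]] linear_diff[OF linear_funpow[OF lin(2)]]
  linear_scale[OF linear_funpow[OF lin(1)]] linear_scale[OF linear_funpow[OF lin(2)]]
  linear_0[OF linear_funpow[OF lin(1)]] linear_0[OF linear_funpow[OF lin(2)]]

lemma e_fpow: "e ((f ^^ Suc n) v) = (f ^^ Suc n) (e v) + real (Suc n) *\<^sub>R (f ^^ n) (h v - real n *\<^sub>R v)"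
proof (induction n arbitrary: v)
  case 0
  then show ?case by (simp add: ef)
next
  case (Suc n)
  have "e ((f ^^ Suc (Suc n)) v) = e ((f ^^ Suc n) (f v))" by (simp add: funpow_swap1)
  also have "\<dots> = (f ^^ Suc n) (e (f v)) + real (Suc n) *\<^sub>R (f ^^ n) (h (f v) - real n *\<^sub>R f v)"
    by (rule Suc.IH)
  also have "h (f v) - real n *\<^sub>R f v = f (h v - (real n + 2) *\<^sub>R v)"
    by (simp add: hf lin_simps algebra_simps)
  also have "(f ^^ n) (f (h v - (real n + 2) *\<^sub>R v)) = (f ^^ Suc n) (h v - (real n + 2) *\<^sub>R v)"
    by (simp add: funpow_swap1)
  also have "e (f v) = f (e v) + h v" by (rule ef)
  also have "(f ^^ Suc n) (f (e v) + h v) = (f ^^ Suc (Suc n)) (e v) + (f ^^ Suc n) (h v)"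
    by (simp only: pow_simps) (simp add: funpow_swap1)
  finally show ?case
    by (simp only: pow_simps) (simp add: algebra_simps scaleR_2 flip: scaleR_scaleR)
qed

lemma h_fpow: "h v = c *\<^sub>R v \<Longrightarrow> h ((f ^^ n) v) = (c - 2 * real n) *\<^sub>R (f ^^ n) v"
proof (induction n)
  case (Suc n)
  then show ?case by (simp add: hf[of "(f ^^ n) v"] lin_simps) (simp add: algebra_simps)
qed simp

text \<open>The polynomial \<open>h (h - 1) ... (h - n + 1)\<close> applied to \<open>v\<close>. Its
  roots are simple and are natural numbers.\<close>

primrec descent :: "nat \<Rightarrow> 'a \<Rightarrow> 'a" where
  "descent 0 v = v"
| "descent (Suc n) v = descent n (h v - real n *\<^sub>R v)"

text \<open>If \<open>e v\<close> vanishes modulo \<open>M\<close>, then \<open>e\<^sup>n f\<^sup>n v\<close> is \<open>n!\<close> times \<open>descent n v\<close> modulo \<open>M\<close>.\<close>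
lemma descent_in_submodule:
  assumes M: "subspace M" "\<And>v. v \<in> M \<Longrightarrow> e v \<in> M" "\<And>v. v \<in> M \<Longrightarrow> f v \<in> M" "\<And>v. v \<in> M \<Longrightarrow> h v \<in> M"
    and "e v \<in> M" and "(e ^^ n) ((f ^^ n) v) \<in> M"
  shows "descent n v \<in> M"
  using assms(5,6)
proof (induction n arbitrary: v)
  case 0
  then show ?case by (simp only: funpow.simps descent.simps id_apply)
next
  case (Suc n)
  let ?v = "h v - real n *\<^sub>R v"
  have fM: "(f ^^ k) u \<in> M" and eM: "(e ^^ k) u \<in> M" if "u \<in> M" for u k
    using that by (induction k) (auto intro: M)
  have "(e ^^ Suc n) ((f ^^ Suc n) v) = (e ^^ n) (e ((f ^^ Suc n) v))" by (simp add: funpow_swap1)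
  also have "\<dots> = (e ^^ n) ((f ^^ Suc n) (e v)) + real (Suc n) *\<^sub>R (e ^^ n) ((f ^^ n) ?v)"
    by (simp only: e_fpow pow_simps)
  finally have "real (Suc n) *\<^sub>R (e ^^ n) ((f ^^ n) ?v) = (e ^^ Suc n) ((f ^^ Suc n) v) - (e ^^ n) ((f ^^ Suc n) (e v))"
    by simp
  also have "\<dots> \<in> M"
    using Suc.prems(2) eM[OF fM[OF Suc.prems(1)]] by (rule subspace_diff[OF M(1)])
  finally have "(1 / real (Suc n)) *\<^sub>R real (Suc n) *\<^sub>R (e ^^ n) ((f ^^ n) ?v) \<in> M"
    by (rule subspace_scale[OF M(1)])
  then have "(e ^^ n) ((f ^^ n) ?v) \<in> M" by simp
  moreover have "e ?v = h (e v) - (real n + 2) *\<^sub>R e v"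
    by (simp add: he lin_simps algebra_simps)
  then have "e ?v \<in> M"
    using Suc.prems(1) M by (auto intro: subspace_diff subspace_scale)
  ultimately show ?case using Suc.IH by simp
qed

lemma descent_eigenvector: "h v = c *\<^sub>R v \<Longrightarrow> descent n v = (\<Prod>j<n. c - real j) *\<^sub>R v"
proof (induction n arbitrary: v)
  case (Suc n)
  have "h v - real n *\<^sub>R v = (c - real n) *\<^sub>R v" using Suc.prems by (simp add: algebra_simps)
  then show ?case using Suc.IH[of "(c - real n) *\<^sub>R v"] Suc.prems by (simp add: lin_simps mult.commute)
qed auto

text \<open>The polynomial has distinct roots, so its kernel is a sum of eigenspaces. The factor
  \<open>h - n\<close> is split off by \<open>eigenspan_eliminate\<close>, since \<open>n\<close> is
  not among the smaller roots.\<close>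

lemma descent_zero_imp_eigenspan: "descent n x = 0 \<Longrightarrow> x \<in> eigenspan h (real ` {..<n})"
proof (induction n arbitrary: x)
  case 0
  then show ?case by (simp add: subspace_0[OF subspace_eigenspan])
next
  case (Suc n)
  have mono: "eigenspan h (real ` {..<n}) \<subseteq> eigenspan h (real ` {..<Suc n})"
    unfolding eigenspan_def by (intro span_mono) auto
  obtain z where z: "z \<in> eigenspan h (real ` {..<n})" "h (x - z) = real n *\<^sub>R (x - z)"
    using eigenspan_eliminate[OF lin(3) Suc.IH, where c = "real n" and x = x] Suc.prems
    by (metis (no_types, lifting) descent.simps(2) image_iff lessThan_iff less_irrefl of_nat_eq_iff)
  then have "x - z \<in> eigenspan h (real ` {..<Suc n})"
    by (intro eigenvector_in_eigenspan) auto
  then show ?case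
    using z(1) mono subspace_add[OF subspace_eigenspan, of "x - z"] by fastforce
qed

text \<open>Some power \<open>f^n\<close> vanishes, so
  \<open>descent n v = c (c - 1) ... (c - n + 1) v\<close> must be zero.\<close>

lemma highest_weight_nonneg:
  assumes "e v = 0" "h v = c *\<^sub>R v" "v \<noteq> 0"
  shows "\<exists>j. c = real j"
proof -
  obtain n where "\<forall>v. (f ^^ n) v = 0" using nilp(2) by blast
  then have "descent n v \<in> {0}"
    using assms(1) by (intro descent_in_submodule) (auto simp: lin_simps pow_simps)
  then have "(\<Prod>j<n. c - real j) = 0"
    using assms by (simp add: descent_eigenvector)
  then show ?thesis by auto
qed

text \<open>Otherwise \<open>f^(l + 1) v\<close> would be a nonzero vector killed by
  \<open>e\<close> and of negative weight \<open>- l - 2\<close>.\<close>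

lemma fpow_highest_weight_vector:
  assumes "e v = 0" "h v = real l *\<^sub>R v"
  shows "(f ^^ Suc l) v = 0"
proof (rule ccontr)
  assume nz: "(f ^^ Suc l) v \<noteq> 0"
  have "e ((f ^^ Suc l) v) = 0"
    using assms by (simp only: e_fpow) (simp add: lin_simps pow_simps)
  moreover have "h ((f ^^ Suc l) v) = (real l - 2 * real (Suc l)) *\<^sub>R (f ^^ Suc l) v"
    using assms(2) by (rule h_fpow)
  ultimately obtain j where "real l - 2 * real (Suc l) = real j"
    using highest_weight_nonneg nz by blast
  then show False by simp
qed

text \<open>Induction on a power of \<open>e\<close> that kills \<open>v\<close>. The vector
  \<open>e v\<close>, of weight \<open>n + 2\<close>, satisfies the same hypotheses, so it is zero;
  then \<open>descent n v = n! v\<close> must vanish.\<close>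

lemma fpow_injective:
  assumes "h v = real n *\<^sub>R v" "(f ^^ n) v = 0"
  shows "v = 0"
proof -
  have "(e ^^ j) v = 0 \<Longrightarrow> v = 0" for j
    using assms
  proof (induction j arbitrary: v n)
    case (Suc j)
    \<comment> \<open>Both terms on the right vanish, because \<open>h v - (n + 1) v = - v\<close>
      and already \<open>f^n v = 0\<close>.\<close>
    have "(f ^^ Suc (Suc n)) (e v) = e ((f ^^ Suc (Suc n)) v)
        - real (Suc (Suc n)) *\<^sub>R (f ^^ Suc n) (h v - real (Suc n) *\<^sub>R v)"
      using e_fpow[of "Suc n" v] by simp
    also have "\<dots> = 0"
      using Suc.prems by (simp add: lin_simps pow_simps)
    finally have *: "(f ^^ (n + 2)) (e v) = 0" by simp
    have "e v = 0"
    proof (rule Suc.IH)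
      show "(e ^^ j) (e v) = 0" using Suc.prems(1) by (simp add: funpow_swap1)
      show "h (e v) = real (n + 2) *\<^sub>R e v"
        using Suc.prems(2) by (simp add: he lin_simps algebra_simps)
    qed (rule *)
    show ?case
    proof (rule ccontr)
      assume "v \<noteq> 0"
      have "(e ^^ n) ((f ^^ n) v) \<in> {0}" using Suc.prems(3) by (simp add: pow_simps)
      then have "descent n v \<in> {0}"
        using \<open>e v = 0\<close> by (intro descent_in_submodule) (auto simp: lin_simps pow_simps)
      then have "(\<Prod>j<n. real n - real j) = 0"
        using Suc.prems(2) \<open>v \<noteq> 0\<close> by (simp add: descent_eigenvector)
      then show False by simp
    qed
  qed auto
  then show ?thesis using nilp(1) by blast
qed

text \<open>The composite \<open>e f\<close> is injective on the eigenspace of \<open>l + 2\<close>: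
  if \<open>e\<close> kills \<open>f v\<close>, of weight \<open>l\<close>, then
  \<open>f^(l + 2) v = 0\<close>, hence \<open>v = 0\<close>. By finite dimension it is also
  surjective there.\<close>

lemma e_surjective:
  assumes y: "h y = real (l + 2) *\<^sub>R y"
  obtains x where "h x = real l *\<^sub>R x" "e x = y"
proof -
  let ?V = "{v. h v = real (l + 2) *\<^sub>R v}"
  have V: "subspace ?V" by (auto simp: subspace_def lin_simps algebra_simps)
  have hfv: "h (f v) = real l *\<^sub>R f v" if "v \<in> ?V" for v
    using that by (simp add: hf lin_simps algebra_simps)
  have sub: "(e \<circ> f) ` ?V \<subseteq> ?V"
    using hfv by (auto simp: he lin_simps algebra_simps)
  have L: "linear (e \<circ> f)" using lin by (intro linear_compose)
  have "inj_on (e \<circ> f) ?V"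
  proof (subst linear_inj_on_iff_eq_0[OF L V], intro ballI impI)
    fix v assume v: "v \<in> ?V" "(e \<circ> f) v = 0"
    have "(f ^^ Suc l) (f v) = 0"
      using hfv[OF v(1)] v(2) by (intro fpow_highest_weight_vector) auto
    then have "(f ^^ (l + 2)) v = 0" by (simp add: funpow_swap1 del: funpow.simps(2)) (simp add: funpow_swap1)
    moreover have "h v = real (l + 2) *\<^sub>R v" using v(1) by blast
    ultimately show "v = 0" using fpow_injective by blast
  qed
  then have "dim ((e \<circ> f) ` ?V) = dim ?V"
    using L V by (intro dim_image_eq) (auto simp: span_eq_iff[THEN iffD2])
  then have "(e \<circ> f) ` ?V = ?V"
    using sub by (intro subspace_dim_equal linear_subspace_image[OF L] V) auto
  moreover have "y \<in> ?V" using y by blast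
  ultimately obtain v where "v \<in> ?V" "y = (e \<circ> f) v" by blast
  then show thesis using that[of "f v"] hfv[of v] by simp
qed

text \<open>The sum \<open>?M\<close> of the integral eigenspaces is a submodule. If it were proper,
  a vector outside it could be corrected by elements of \<open>?M\<close> until \<open>e\<close>
  kills it exactly and not only modulo \<open>?M\<close>; but such a vector lies in
  \<open>?M\<close>.\<close>

theorem eigenspan_h_Ints: "eigenspan h \<int> = UNIV"
proof (rule ccontr)
  let ?M = "eigenspan h \<int>"
  have M: "subspace ?M" by (rule subspace_eigenspan)
  have stable: "g v \<in> ?M" if g: "linear g" and c: "\<And>u k. h u = k *\<^sub>R u \<Longrightarrow> k \<in> \<int> \<Longrightarrow> g u \<in> ?M"
    and v: "v \<in> ?M" for g v
    using v unfolding eigenspan_def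
  proof (induction rule: span_induct_alt)
    case base
    then show ?case by (simp add: linear_0[OF g] span_0)
  next
    case (step a x y)
    then have "g x \<in> ?M" using c by auto
    with step show ?case
      by (auto simp: linear_add[OF g] linear_scale[OF g] eigenspan_def intro: span_add span_scale)
  qed
  have eM: "e v \<in> ?M" if "v \<in> ?M" for v
  proof (rule stable[OF lin(1) _ that])
    fix u k assume "h u = k *\<^sub>R u" "k \<in> \<int>"
    then have "h (e u) = (k + 2) *\<^sub>R e u" "k + 2 \<in> \<int>" by (auto simp: he lin_simps algebra_simps)
    then show "e u \<in> ?M" by (rule eigenvector_in_eigenspan)
  qed
  have fM: "f v \<in> ?M" if "v \<in> ?M" for v
  proof (rule stable[OF lin(2) _ that])
    fix u k assume "h u = k *\<^sub>R u" "k \<in> \<int>"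
    then have "h (f u) = (k - 2) *\<^sub>R f u" "k - 2 \<in> \<int>" by (auto simp: hf lin_simps algebra_simps)
    then show "f u \<in> ?M" by (rule eigenvector_in_eigenspan)
  qed
  have hM: "h v \<in> ?M" if "v \<in> ?M" for v
    by (rule stable[OF lin(3) _ that]) (auto intro: subspace_scale[OF M] eigenvector_in_eigenspan)
  \<comment> \<open>Some factor \<open>h - j\<close> of the descent polynomial is the first to carry
    the running vector into \<open>?M\<close>; \<open>y\<close> is the vector just before.\<close>
  have *: "\<exists>y j. y \<notin> ?M \<and> e y \<in> ?M \<and> h y - real j *\<^sub>R y \<in> ?M"
    if "descent n x \<in> ?M" "x \<notin> ?M" "e x \<in> ?M" for n x
    using that
  proof (induction n arbitrary: x)
    case (Suc n)
    have ex: "e (h x - real n *\<^sub>R x) = h (e x) - (real n + 2) *\<^sub>R e x"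
      by (simp add: he lin_simps algebra_simps)
    have "e (h x - real n *\<^sub>R x) \<in> ?M"
      unfolding ex using Suc.prems(3) by (intro subspace_diff subspace_scale M hM)
    then show ?case using Suc by (cases "h x - real n *\<^sub>R x \<in> ?M") auto
  qed auto
  assume "?M \<noteq> UNIV"
  then obtain x0 where x0: "x0 \<notin> ?M" by blast
  obtain n where n: "\<forall>v. (e ^^ n) v = 0" using nilp(1) by blast
  have "\<exists>y. y \<notin> ?M \<and> e y \<in> ?M" if "x \<notin> ?M" "(e ^^ k) x \<in> ?M" for k x
    using that
  proof (induction k arbitrary: x)
    case (Suc k)
    then show ?case by (cases "e x \<in> ?M") (auto simp: funpow_swap1)
  qed auto
  then obtain x1 where x1: "x1 \<notin> ?M" "e x1 \<in> ?M" using x0 n subspace_0[OF M] by metis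
  obtain n' where n': "\<forall>v. (f ^^ n') v = 0" using nilp(2) by blast
  have "(e ^^ n') ((f ^^ n') x1) \<in> ?M" using n' by (simp add: pow_simps subspace_0[OF M])
  with M eM fM hM x1(2) have "descent n' x1 \<in> ?M" by (rule descent_in_submodule)
  with * x1 obtain x2 l where x2: "x2 \<notin> ?M" "e x2 \<in> ?M" "h x2 - real l *\<^sub>R x2 \<in> ?M" by blast
  then obtain z where z: "z \<in> ?M"
    "h (h (x2 - z) - real l *\<^sub>R (x2 - z)) = real l *\<^sub>R (h (x2 - z) - real l *\<^sub>R (x2 - z))"
    using eigenspan_eliminate[OF lin(3)] by blast
  \<comment> \<open>Passing from \<open>x2\<close> to \<open>x3\<close> stays outside
    \<open>?M\<close> and makes the square of \<open>h - l\<close> vanish on the vector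
    itself.\<close>
  define x3 where "x3 = x2 - z"
  note y3 = z(2)[folded x3_def] and zM = z(1)
  have x3: "x3 \<notin> ?M" using x2(1) subspace_add[OF M _ zM, of x3] by (auto simp: x3_def)
  have ex3: "e x3 \<in> ?M" unfolding x3_def lin_simps by (rule subspace_diff[OF M x2(2) eM[OF zM]])
  obtain S' d where S': "finite S'" "S' \<subseteq> \<int>" "\<And>s. h (d s) = s *\<^sub>R d s" "e x3 = (\<Sum>s\<in>S'. d s)"
    using eigenspan_decomposition[OF lin(3) ex3] by metis
  let ?m = "real (l + 2)"
  define N where "N v = h v - ?m *\<^sub>R v" for v
  have linN: "linear N" unfolding N_def by (intro linearI) (simp_all add: lin_simps algebra_simps)
  \<comment> \<open>Since \<open>(h - l - 2) e = e (h - l)\<close>, the square of \<open>N\<close>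
    kills \<open>e x3\<close>. This vector lies in \<open>?M\<close>, where \<open>h\<close> is
    diagonalizable, so \<open>N\<close> itself kills it.\<close>
  have "N (N (e x3)) = e (h (h x3 - real l *\<^sub>R x3) - real l *\<^sub>R (h x3 - real l *\<^sub>R x3))"
    by (simp add: N_def he lin_simps algebra_simps)
  then have "N (N (e x3)) = 0" by (simp add: y3 linear_0[OF lin(1)])
  moreover have Nd: "N (d s) = (s - ?m) *\<^sub>R d s" for s
    by (simp add: N_def S'(3) scaleR_left_diff_distrib)
  ultimately have sum0: "(\<Sum>s\<in>S'. ((s - ?m) * (s - ?m)) *\<^sub>R d s) = 0"
    by (simp add: S'(4) linear_sum[OF linN] linear_scale[OF linN] Nd)
  have "((s - ?m) * (s - ?m)) *\<^sub>R d s = 0" if "s \<in> S'" for s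
    using eigencomponents_zero[OF lin(3) S'(1) _ sum0 that] by (simp add: lin_simps S'(3))
  then have "N (d s) = 0" if "s \<in> S'" for s
    using that by (auto simp: Nd)
  then have "h (e x3) = ?m *\<^sub>R e x3"
    by (simp add: N_def S'(4) linear_sum[OF lin(3)] scaleR_right.sum)
  then obtain x' where x': "h x' = real l *\<^sub>R x'" "e x' = e x3" using e_surjective by blast
  \<comment> \<open>Now \<open>e\<close> kills \<open>x4\<close> exactly, so
    \<open>descent_in_submodule\<close> applies with the zero submodule.\<close>
  define x4 where "x4 = x3 - x'"
  have x'M: "x' \<in> ?M" using x'(1) by (rule eigenvector_in_eigenspan) simp
  have x4: "x4 \<notin> ?M" using x3 subspace_add[OF M _ x'M, of x4] by (auto simp: x4_def)
  have ex4: "e x4 = 0" by (simp add: x4_def lin_simps x')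
  have "descent n' x4 \<in> {0}"
    using n' ex4 by (intro descent_in_submodule) (auto simp: lin_simps pow_simps)
  then have "x4 \<in> eigenspan h (real ` {..<n'})" by (simp add: descent_zero_imp_eigenspan)
  also have "\<dots> \<subseteq> ?M" unfolding eigenspan_def by (intro span_mono) auto
  finally show False using x4 by simp
qed

end

section \<open>Weights of representations of \<open>sl\<^sub>3\<close>\<close>

lemma matrix_mult_linear:
  fixes A B C :: "real^'n^'n"
  shows "A ** (B - C) = A ** B - A ** C" "(B - C) ** A = B ** A - C ** A"
    "A ** (B + C) = A ** B + A ** C" "(B + C) ** A = B ** A + C ** A"
    "A ** (c *\<^sub>R B) = c *\<^sub>R (A ** B)" "(c *\<^sub>R B) ** A = c *\<^sub>R (B ** A)"
  by (simp_all add: vec_eq_iff matrix_matrix_mult_def algebra_simps sum_subtractf sum.distrib sum_distrib_left)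

text \<open>The powers satisfy \<open>[H, A^k] = k c A^k\<close>. If none vanished, the operator
  \<open>M \<mapsto> [H, M]\<close> would have infinitely many eigenvalues.\<close>

lemma matrix_nilpotent_if_weight_vector:
  fixes H A :: "real^'n^'n"
  assumes HA: "H ** A - A ** H = c *\<^sub>R A" and "c \<noteq> 0"
  shows "\<exists>n. \<forall>v. ((*v) A ^^ n) v = 0"
proof -
  define P where "P k = (((**) A) ^^ k) (mat 1)" for k
  have P: "P 0 = mat 1" "P (Suc k) = A ** P k" for k by (simp_all add: P_def)
  have Pv: "((*v) A ^^ k) v = P k *v v" for k v
    by (induction k) (simp_all add: P matrix_vector_mul_assoc)
  have comm: "H ** P k - P k ** H = (real k * c) *\<^sub>R P k" for k
  proof (induction k)
    case (Suc k)
    have "H ** P (Suc k) - P (Suc k) ** H = (H ** A - A ** H) ** P k + A ** (H ** P k - P k ** H)"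
      by (simp add: P matrix_mult_linear matrix_mul_assoc)
    also have "\<dots> = (real (Suc k) * c) *\<^sub>R P (Suc k)"
      unfolding HA Suc by (simp add: P matrix_mult_linear algebra_simps)
    finally show ?case .
  qed (simp add: P)
  define ad where "ad M = H ** M - M ** H" for M
  have "linear ad"
    unfolding ad_def
    by (intro linearI) (simp_all add: matrix_mult_linear scaleR_right_diff_distrib)
  then have fin: "finite {d. \<exists>M. M \<noteq> 0 \<and> ad M = d *\<^sub>R M}" by (rule finite_eigenvalues)
  have "\<exists>k. P k = 0"
  proof (rule ccontr)
    assume "\<nexists>k. P k = 0"
    then have "range (\<lambda>k. real k * c) \<subseteq> {d. \<exists>M. M \<noteq> 0 \<and> ad M = d *\<^sub>R M}"
      using comm by (auto simp: ad_def)
    then have "finite (range (\<lambda>k. real k * c))" using fin by (rule finite_subset)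
    moreover have "inj (\<lambda>k. real k * c)" using \<open>c \<noteq> 0\<close> by (auto simp: inj_def)
    ultimately show False by (simp add: finite_image_iff)
  qed
  then show ?thesis using Pv by (metis matrix_vector_mult_0)
qed

section \<open>Matrix units, diagonal matrices and roots\<close>

definition E :: "3 \<Rightarrow> 3 \<Rightarrow> real^3^3" where
  "E i j = (\<chi> a b. if a = i \<and> b = j then 1 else 0)"

definition D :: "real^3 \<Rightarrow> real^3^3" where
  "D t = (\<chi> a b. if a = b then t $ a else 0)"

text \<open>Used both for the diagonals of traceless diagonal matrices and for the vectors that
  represent weights through the inner product.\<close>

definition zsum :: "real^3 \<Rightarrow> bool" where
  "zsum t \<longleftrightarrow> t $ 1 + t $ 2 + t $ 3 = 0"

text \<open>Serves as the root of \<open>E i j\<close> and also as its coroot: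
  \<open>D (rootvec i j)\<close> is the commutator of \<open>E i j\<close> and
  \<open>E j i\<close>.\<close>

definition rootvec :: "3 \<Rightarrow> 3 \<Rightarrow> real^3" where
  "rootvec i j = axis i 1 - axis j 1"

lemma root_nth: "rootvec i j $ k = (if k = i then 1 else 0) - (if k = j then 1 else 0)"
  by (simp add: rootvec_def axis_def)

lemma inner_root: "rootvec i j \<bullet> t = t $ i - t $ j"
  by (simp add: rootvec_def inner_diff_left inner_axis')

lemma zsum_root: "zsum (rootvec i j)"
  using exhaust_3[of i] exhaust_3[of j] by (auto simp: zsum_def root_nth)

lemma zsum_arith: "zsum s \<Longrightarrow> zsum t \<Longrightarrow> zsum (s + t)" "zsum s \<Longrightarrow> zsum t \<Longrightarrow> zsum (s - t)"
  "zsum t \<Longrightarrow> zsum (c *\<^sub>R t)" "zsum t \<Longrightarrow> zsum (- t)"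
  by (simp_all add: zsum_def algebra_simps) algebra+

lemma E_in_sl3: "i \<noteq> j \<Longrightarrow> E i j \<in> sl3"
  by (auto simp: sl3_def trace_def E_def intro!: sum.neutral)

lemma D_in_sl3: "zsum t \<Longrightarrow> D t \<in> sl3"
  by (simp add: sl3_def trace_def D_def sum_3 zsum_def)

lemma E_mult: "E i j ** E k l = (if j = k then E i l else 0)"
  by (auto simp: E_def matrix_matrix_mult_def vec_eq_iff if_distrib[of "\<lambda>x. x * _"] cong: if_cong)

lemma D_E: "D t ** E i j = (t $ i) *\<^sub>R E i j"
  by (auto simp: E_def D_def matrix_matrix_mult_def vec_eq_iff if_distrib[of "\<lambda>x. x * _"] cong: if_cong)

lemma E_D: "E i j ** D t = (t $ j) *\<^sub>R E i j"
  by (auto simp: E_def D_def matrix_matrix_mult_def vec_eq_iff if_distrib[of "\<lambda>x. _ * x"] cong: if_cong)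

lemma D_D: "D s ** D t = D t ** D s"
  by (auto simp: D_def matrix_matrix_mult_def vec_eq_iff if_distrib[of "\<lambda>x. x * _"] if_distrib[of "\<lambda>x. _ * x"] cong: if_cong)

lemma E_diff_eq_D: "E i i - E j j = D (rootvec i j)"
  by (auto simp: E_def D_def vec_eq_iff root_nth)

lemma D_linear: "D (a *\<^sub>R s + b *\<^sub>R t) = a *\<^sub>R D s + b *\<^sub>R D t"
  by (simp add: D_def vec_eq_iff)

lemma sl3_arith: "X \<in> sl3 \<Longrightarrow> Y \<in> sl3 \<Longrightarrow> X + Y \<in> sl3" "X \<in> sl3 \<Longrightarrow> Y \<in> sl3 \<Longrightarrow> X - Y \<in> sl3"
  "X \<in> sl3 \<Longrightarrow> c *\<^sub>R X \<in> sl3" "0 \<in> sl3"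
  by (simp_all add: sl3_def trace_def sum.distrib sum_subtractf flip: sum_distrib_left)

lemma commutator_in_sl3: "X ** Y - Y ** X \<in> sl3"
  by (simp add: sl3_def trace_sub trace_mul_sym[of X Y])

section \<open>Weight vectors, integrality and Weyl reflections\<close>

locale sl3_representation =
  fixes rho :: "real^3^3 \<Rightarrow> real^'n^'n"
  assumes rep: "sl3_rep rho"
begin

lemma rho_comb: "X \<in> sl3 \<Longrightarrow> Y \<in> sl3 \<Longrightarrow> rho (a *\<^sub>R X + b *\<^sub>R Y) = a *\<^sub>R rho X + b *\<^sub>R rho Y"
  using rep by (simp add: sl3_rep_def)

lemma rho_add: "X \<in> sl3 \<Longrightarrow> Y \<in> sl3 \<Longrightarrow> rho (X + Y) = rho X + rho Y"
  using rho_comb[of X Y 1 1] by simp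

lemma rho_diff: "X \<in> sl3 \<Longrightarrow> Y \<in> sl3 \<Longrightarrow> rho (X - Y) = rho X - rho Y"
  using rho_comb[of X Y 1 "-1"] by simp

lemma rho_scale: "X \<in> sl3 \<Longrightarrow> rho (c *\<^sub>R X) = c *\<^sub>R rho X"
  using rho_comb[of X X c 0] by simp

lemma rho_zero: "rho 0 = 0"
  using rho_scale[of 0 0] by (simp add: sl3_arith)

lemma rho_bracket:
  "X \<in> sl3 \<Longrightarrow> Y \<in> sl3 \<Longrightarrow> rho X *v (rho Y *v v) = rho Y *v (rho X *v v) + rho (X ** Y - Y ** X) *v v"
  using rep by (simp add: sl3_rep_def matrix_vector_mul_assoc matrix_vector_mult_diff_rdistrib)

lemma sl2_module:
  assumes "i \<noteq> j"
  shows "sl2_module ((*v) (rho (E i j))) ((*v) (rho (E j i))) ((*v) (rho (D (rootvec i j))))"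
proof -
  have sl: "E i j \<in> sl3" "E j i \<in> sl3" "D (rootvec i j) \<in> sl3"
    using assms by (simp_all add: E_in_sl3 D_in_sl3 zsum_root)
  have comm: "rho X ** rho Y - rho Y ** rho X = rho (X ** Y - Y ** X)" if "X \<in> sl3" "Y \<in> sl3" for X Y
    using rep that by (simp add: sl3_rep_def)
  have rt: "rootvec i j $ i = 1" "rootvec i j $ j = -1" using assms by (simp_all add: root_nth)
  have b: "D (rootvec i j) ** E i j - E i j ** D (rootvec i j) = 2 *\<^sub>R E i j"
    "D (rootvec i j) ** E j i - E j i ** D (rootvec i j) = (-2) *\<^sub>R E j i"
    "E i j ** E j i - E j i ** E i j = D (rootvec i j)"
    by (simp_all add: D_E E_D E_mult rt E_diff_eq_D) (simp_all add: vec_eq_iff)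
  show ?thesis
  proof
    show "rho (D (rootvec i j)) *v (rho (E i j) *v v)
        = rho (E i j) *v (rho (D (rootvec i j)) *v v) + 2 *\<^sub>R (rho (E i j) *v v)" for v
      using rho_bracket[OF sl(3,1), of v] sl
      by (simp add: b rho_scale scaleR_matrix_vector_assoc)
    show "rho (D (rootvec i j)) *v (rho (E j i) *v v)
        = rho (E j i) *v (rho (D (rootvec i j)) *v v) - 2 *\<^sub>R (rho (E j i) *v v)" for v
      using rho_bracket[OF sl(3,2), of v]
      unfolding b rho_scale[OF sl(2)] scaleR_matrix_vector_assoc[symmetric] by simp
    show "rho (E i j) *v (rho (E j i) *v v) = rho (E j i) *v (rho (E i j) *v v) + rho (D (rootvec i j)) *v v" for v
      using rho_bracket[OF sl(1,2), of v] by (simp add: b)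
    show "\<exists>n. \<forall>v. ((*v) (rho (E i j)) ^^ n) v = 0"
      by (rule matrix_nilpotent_if_weight_vector[of "rho (D (rootvec i j))" _ 2])
        (use comm[OF sl(3,1)] sl in \<open>simp_all add: b rho_scale\<close>)
    show "\<exists>n. \<forall>v. ((*v) (rho (E j i)) ^^ n) v = 0"
      by (rule matrix_nilpotent_if_weight_vector[of "rho (D (rootvec i j))" _ "-2"])
        (use comm[OF sl(3,2)] rho_scale[OF sl(2), of "-2"] in \<open>simp_all add: b\<close>)
  qed (simp_all add: algebra_simps)
qed

definition weight_vector :: "real^3 \<Rightarrow> real^'n \<Rightarrow> bool" where
  "weight_vector x v \<longleftrightarrow> (\<forall>t. zsum t \<longrightarrow> rho (D t) *v v = (x \<bullet> t) *\<^sub>R v)"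

text \<open>Since \<open>t\<close> ranges over the zero-sum plane only, adding a multiple of (1, 1,
  1) to \<open>x\<close> leaves \<open>weight_vector x\<close> unchanged; \<open>zsum x\<close>
  makes the representing vector unique.\<close>

definition weights :: "(real^3) set" where
  "weights = {x. zsum x \<and> (\<exists>v. v \<noteq> 0 \<and> weight_vector x v)}"

lemma weight_vectorD: "weight_vector x v \<Longrightarrow> zsum t \<Longrightarrow> rho (D t) *v v = (x \<bullet> t) *\<^sub>R v"
  by (simp add: weight_vector_def)

lemma weight_vector_root: "weight_vector x v \<Longrightarrow> rho (D (rootvec i j)) *v v = (x $ i - x $ j) *\<^sub>R v"
  by (simp add: weight_vectorD zsum_root inner_commute[of x] inner_root)

lemma not_weightD: "weight_vector x v \<Longrightarrow> zsum x \<Longrightarrow> x \<notin> weights \<Longrightarrow> v = 0"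
  by (auto simp: weights_def)

lemma weight_vector_E:
  assumes "i \<noteq> j" "weight_vector x v"
  shows "weight_vector (x + rootvec i j) (rho (E i j) *v v)"
  unfolding weight_vector_def
proof (intro allI impI)
  fix t assume t: "zsum t"
  have "rho (D t) *v (rho (E i j) *v v) = rho (E i j) *v (rho (D t) *v v) + rho (D t ** E i j - E i j ** D t) *v v"
    by (intro rho_bracket D_in_sl3 E_in_sl3 assms t)
  also have "D t ** E i j - E i j ** D t = (t $ i - t $ j) *\<^sub>R E i j"
    by (simp add: D_E E_D scaleR_left_diff_distrib)
  also have "rho \<dots> = (t $ i - t $ j) *\<^sub>R rho (E i j)"
    by (intro rho_scale E_in_sl3 assms)
  finally show "rho (D t) *v (rho (E i j) *v v) = ((x + rootvec i j) \<bullet> t) *\<^sub>R (rho (E i j) *v v)"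
    using weight_vectorD[OF assms(2) t]
    by (simp add: inner_add_left inner_root matrix_vector_mult_scaleR scaleR_add_left flip: scaleR_matrix_vector_assoc)
qed

lemma weight_vector_E_pow:
  assumes "i \<noteq> j" "weight_vector x v"
  shows "weight_vector (x + real n *\<^sub>R rootvec i j) (((*v) (rho (E i j)) ^^ n) v)"
proof (induction n)
  case (Suc n)
  then show ?case using weight_vector_E[OF assms(1) Suc] by (simp add: algebra_simps)
qed (use assms in simp)

text \<open>The operators of two simple coroots commute and are diagonalizable, hence have a
  spanning set of joint eigenvectors; the two coroots span the zero-sum plane.\<close>

lemma weight_spaces_span: "span {v. \<exists>x. zsum x \<and> weight_vector x v} = UNIV"
proof -
  let ?W = "{v. \<exists>x. zsum x \<and> weight_vector x v}"
  let ?h1 = "(*v) (rho (D (rootvec 1 2)))" and ?h2 = "(*v) (rho (D (rootvec 2 3)))"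
  have sl: "D (rootvec 1 2) \<in> sl3" "D (rootvec 2 3) \<in> sl3" by (simp_all add: D_in_sl3 zsum_root)
  have comm: "?h1 (?h2 v) = ?h2 (?h1 v)" for v
    using rho_bracket[OF sl, of v] by (simp add: D_D[of "rootvec 1 2" "rootvec 2 3"] rho_zero)
  have E1: "eigenspan ?h1 \<int> = UNIV" and E2: "eigenspan ?h2 \<int> = UNIV"
    using sl2_module.eigenspan_h_Ints[OF sl2_module] by simp_all
  have lin: "linear ?h1" "linear ?h2" by simp_all
  have joint: "v \<in> ?W" if v: "?h1 v = s *\<^sub>R v" "?h2 v = r *\<^sub>R v" for s r v
  proof -
    \<comment> \<open>The zero-sum solution of \<open>x\<^sub>1 - x\<^sub>2 = s\<close> and
      \<open>x\<^sub>2 - x\<^sub>3 = r\<close>.\<close>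
    define x :: "real^3" where "x = vector [(2 * s + r) / 3, (r - s) / 3, - (s + 2 * r) / 3]"
    have "zsum x" by (simp add: zsum_def x_def) (simp add: field_simps)
    moreover have "weight_vector x v"
      unfolding weight_vector_def
    proof (intro allI impI)
      fix t assume t: "zsum t"
      then have t2: "t $ 2 = - t $ 1 - t $ 3" by (simp add: zsum_def)
      have "t = (t $ 1) *\<^sub>R rootvec 1 2 + (- t $ 3) *\<^sub>R rootvec 2 3"
        by (simp add: vec_eq_iff forall_3 root_nth t2)
      then have "D t = (t $ 1) *\<^sub>R D (rootvec 1 2) + (- t $ 3) *\<^sub>R D (rootvec 2 3)"
        by (metis D_linear)
      then have "rho (D t) *v v = (t $ 1) *\<^sub>R ?h1 v + (- t $ 3) *\<^sub>R ?h2 v"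
        by (simp only: rho_comb[OF sl] matrix_vector_mult_add_rdistrib scaleR_matrix_vector_assoc)
      also have "\<dots> = (s * t $ 1 - r * t $ 3) *\<^sub>R v"
        unfolding v by (simp add: algebra_simps)
      also have "s * t $ 1 - r * t $ 3 = x \<bullet> t"
        by (simp add: inner_vec_def sum_3 x_def t2) (simp add: field_simps)
      finally show "rho (D t) *v v = (x \<bullet> t) *\<^sub>R v" .
    qed
    ultimately show ?thesis by blast
  qed
  have "v \<in> span ?W" for v
  proof -
    obtain S c where S: "finite S" "\<And>s. ?h1 (c s) = s *\<^sub>R c s" "v = (\<Sum>s\<in>S. c s)"
      using eigenspan_decomposition[OF lin(1), of v \<int>] E1 by (metis UNIV_I)
    have "c s \<in> span ?W" for s
    proof -
      obtain R d where R: "finite R" "\<And>s. ?h2 (d s) = s *\<^sub>R d s" "c s = (\<Sum>s\<in>R. d s)"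
        using eigenspan_decomposition[OF lin(2), of "c s" \<int>] E2 by (metis UNIV_I)
      \<comment> \<open>The \<open>s\<close>-eigenspace of \<open>?h1\<close> is stable under
        \<open>?h2\<close>, so it contains the \<open>?h2\<close>-components of
        \<open>c s\<close>.\<close>
      have "\<forall>r\<in>R. d r \<in> {u. ?h1 u = s *\<^sub>R u}"
      proof (rule eigencomponents_in_invariant_subspace[OF lin(2) R(1)])
        show "subspace {u. ?h1 u = s *\<^sub>R u}"
          by (auto simp: subspace_def matrix_vector_right_distrib matrix_vector_mult_scaleR algebra_simps)
        show "?h2 u \<in> {u. ?h1 u = s *\<^sub>R u}" if "u \<in> {u. ?h1 u = s *\<^sub>R u}" for u
          using that by (simp add: comm matrix_vector_mult_scaleR)
        show "(\<Sum>r\<in>R. d r) \<in> {u. ?h1 u = s *\<^sub>R u}" using S(2)[of s] unfolding R(3)[symmetric] by blast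
      qed (rule R(2))
      then have "d r \<in> ?W" if "r \<in> R" for r using joint[of "d r" s r] R(2) that by blast
      then show ?thesis unfolding R(3) by (intro span_sum span_base)
    qed
    then show ?thesis unfolding S(3) by (intro span_sum)
  qed
  then show ?thesis by blast
qed

text \<open>If the eigenvalue of \<open>v\<close> were not integral, an expansion of
  \<open>v\<close> into integral eigenvectors would have only zero terms.\<close>

lemma weight_integral:
  assumes "x \<in> weights" "i \<noteq> j"
  shows "x $ i - x $ j \<in> \<int>"
proof -
  let ?h = "(*v) (rho (D (rootvec i j)))"
  obtain v where v: "v \<noteq> 0" "weight_vector x v" using assms by (auto simp: weights_def)
  then have hv: "?h v = (x $ i - x $ j) *\<^sub>R v" by (simp add: weight_vector_root)
  have lin: "linear ?h" by simp
  have "v \<in> eigenspan ?h \<int>"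
    using sl2_module.eigenspan_h_Ints[OF sl2_module[OF assms(2)]] by simp
  then obtain S c where S: "finite S" "S \<subseteq> \<int>" "\<And>s. ?h (c s) = s *\<^sub>R c s" "v = (\<Sum>s\<in>S. c s)"
    using eigenspan_decomposition[OF lin] by metis
  have eq: "(\<Sum>s\<in>S. (s - (x $ i - x $ j)) *\<^sub>R c s) = ?h v - (x $ i - x $ j) *\<^sub>R v"
    unfolding S(4) by (simp add: linear_sum[OF lin] S(3) scaleR_left_diff_distrib sum_subtractf scaleR_right.sum)
  have "(s - (x $ i - x $ j)) *\<^sub>R c s = 0" if "s \<in> S" for s
    using eigencomponents_zero[OF lin S(1) _ _ that, where v = "\<lambda>s. (s - (x $ i - x $ j)) *\<^sub>R c s"]
    by (simp add: eq hv S(3) matrix_vector_mult_scaleR)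
  then have "(\<Sum>s\<in>S. c s) = 0" if "x $ i - x $ j \<notin> S"
    using that by (intro sum.neutral) (metis eq_iff_diff_eq_0 scaleR_eq_0_iff)
  then show ?thesis using S v(1) by blast
qed

lemma finite_weights: "finite weights"
proof -
  let ?f = "\<lambda>x::real^3. (x $ 1 - x $ 2, x $ 2 - x $ 3)"
  let ?C = "\<lambda>i j. {c. \<exists>v. v \<noteq> 0 \<and> rho (D (rootvec i j)) *v v = c *\<^sub>R v}"
  have "inj_on ?f weights"
    by (rule inj_onI) (auto simp: weights_def zsum_def vec_eq_iff forall_3)
  moreover have "?f ` weights \<subseteq> ?C 1 2 \<times> ?C 2 3"
    using weight_vector_root by (fastforce simp: weights_def)
  moreover have "finite (?C i j)" for i j by (rule finite_eigenvalues) simp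
  ultimately show ?thesis by (meson finite_SigmaI finite_imageD finite_subset)
qed

lemma weight_E_pow:
  assumes ij: "i \<noteq> j" and v: "weight_vector x v" "v \<noteq> 0" and n: "x $ i - x $ j = real n"
  shows "((*v) (rho (E j i)) ^^ n) v \<noteq> 0"
proof
  interpret sl2_module "(*v) (rho (E i j))" "(*v) (rho (E j i))" "(*v) (rho (D (rootvec i j)))"
    using ij by (rule sl2_module)
  assume "((*v) (rho (E j i)) ^^ n) v = 0"
  with weight_vector_root[OF v(1)] n fpow_injective show False using v(2) by metis
qed

lemma weight_lower:
  assumes ij: "i \<noteq> j" and v: "weight_vector x v" "v \<noteq> 0" "zsum x" and pos: "x $ i - x $ j > 0"
  shows "rho (E j i) *v v \<noteq> 0"
proof
  assume 0: "rho (E j i) *v v = 0"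
  have "x $ i - x $ j \<in> \<int>" using v ij by (intro weight_integral) (auto simp: weights_def)
  then obtain m where m: "x $ i - x $ j = real m"
    by (metis pos Ints_cases less_imp_le nonneg_int_cases of_int_0_le_iff of_int_of_nat_eq)
  with pos obtain n where n: "x $ i - x $ j = real (Suc n)" by (cases m) auto
  have "((*v) (rho (E j i)) ^^ Suc n) v = ((*v) (rho (E j i)) ^^ n) 0"
    using 0 by (simp add: funpow_swap1)
  also have "\<dots> = 0" by (rule linear_0) (intro linear_funpow, simp)
  finally show False using weight_E_pow[OF ij v(1,2) n] by blast
qed

text \<open>If \<open>n = x\<^sub>i - x\<^sub>j\<close> is nonnegative, the \<open>n\<close>-th
  power of \<open>E j i\<close> moves weight \<open>x\<close> to its mirror image and does not kill
  \<open>v\<close>. For the other sign, \<open>i\<close> and \<open>j\<close> are exchanged.\<close>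

lemma weights_reflect:
  assumes x: "x \<in> weights" and ij: "i \<noteq> j"
  shows "x - (x $ i - x $ j) *\<^sub>R rootvec i j \<in> weights"
proof -
  have *: "x - (x $ i - x $ j) *\<^sub>R rootvec i j \<in> weights" if ij: "i \<noteq> j" and nonneg: "x $ i - x $ j \<ge> 0" for i j
  proof -
    have "x $ i - x $ j \<in> \<int>" using x ij by (rule weight_integral)
    then obtain n where n: "x $ i - x $ j = real n"
      by (metis nonneg Ints_cases nonneg_int_cases of_int_0_le_iff of_int_of_nat_eq)
    obtain v where v: "v \<noteq> 0" "weight_vector x v" "zsum x" using x by (auto simp: weights_def)
    have "weight_vector (x + real n *\<^sub>R rootvec j i) (((*v) (rho (E j i)) ^^ n) v)"
      using ij v by (intro weight_vector_E_pow) auto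
    moreover have nz: "((*v) (rho (E j i)) ^^ n) v \<noteq> 0" using weight_E_pow ij v(1,2) n by blast
    moreover have "x - (x $ i - x $ j) *\<^sub>R rootvec i j = x + real n *\<^sub>R rootvec j i"
      by (simp add: n rootvec_def algebra_simps)
    ultimately have "weight_vector (x - (x $ i - x $ j) *\<^sub>R rootvec i j) (((*v) (rho (E j i)) ^^ n) v)"
      by metis
    then show ?thesis
      using v(3) nz unfolding weights_def by (blast intro: zsum_arith zsum_root)
  qed
  show ?thesis
  proof (cases "x $ i - x $ j \<ge> 0")
    case False
    then have "x - (x $ j - x $ i) *\<^sub>R rootvec j i \<in> weights" using * ij by simp
    then show ?thesis by (simp add: rootvec_def algebra_simps)
  qed (use * ij in blast)
qed

end

section \<open>Weights in the presence of a wedge map\<close>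

text \<open>The projection of the \<open>i\<close>-th unit vector to the zero-sum plane. These are
  the weights of E; \<open>-2 eps i\<close> is the weight of the square of the \<open>i\<close>-th
  coordinate function on E.\<close>

definition eps :: "3 \<Rightarrow> real^3" where
  "eps i = (\<chi> k. (if k = i then 1 else 0) - 1 / 3)"

lemma eps_nth: "eps i $ k = (if k = i then 2 / 3 else - 1 / 3)"
  by (simp add: eps_def)

lemma zsum_eps: "zsum (eps i)"
  using exhaust_3[of i] by (auto simp: zsum_def eps_nth)

lemma distinct_indices:
  fixes i j k :: 3
  assumes "i \<noteq> j" "i \<noteq> k" "j \<noteq> k"
  shows "(UNIV :: 3 set) = {i, j, k}"
  using assms exhaust_3[of i] exhaust_3[of j] exhaust_3[of k] by (auto simp: UNIV_3)

lemma other_indices: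
  fixes i :: 3
  obtains j k where "i \<noteq> j" "i \<noteq> k" "j \<noteq> k"
  using exhaust_3[of i] by (elim disjE) (auto intro: that[of 2 3] that[of 1 3] that[of 1 2])

lemma inner_distinct:
  fixes i j k :: 3 and x y :: "real^3"
  assumes "i \<noteq> j" "i \<noteq> k" "j \<noteq> k"
  shows "x \<bullet> y = x $ i * y $ i + x $ j * y $ j + x $ k * y $ k"
  using assms by (simp add: inner_vec_def distinct_indices[OF assms])

lemma zsum_distinct:
  fixes i j k :: 3
  assumes "i \<noteq> j" "i \<noteq> k" "j \<noteq> k"
  shows "zsum x \<longleftrightarrow> x $ i + x $ j + x $ k = 0"
  using assms exhaust_3[of i] exhaust_3[of j] exhaust_3[of k] by (auto simp: zsum_def)

lemma vec_eq_distinct: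
  fixes i j k :: 3
  assumes "i \<noteq> j" "i \<noteq> k" "j \<noteq> k"
  shows "x = y \<longleftrightarrow> x $ i = y $ i \<and> x $ j = y $ j \<and> x $ k = y $ k"
proof -
  have "(\<forall>l. x $ l = y $ l) \<longleftrightarrow> (\<forall>l\<in>{i,j,k}. x $ l = y $ l)"
    by (simp flip: distinct_indices[OF assms])
  then show ?thesis by (simp add: vec_eq_iff)
qed

lemma inner_eps: "zsum z \<Longrightarrow> z \<bullet> eps a = z $ a"
  using exhaust_3[of a] by (auto simp: inner_vec_def sum_3 zsum_def eps_nth algebra_simps)

lemma eps_inner_eps: "eps a \<bullet> eps a = 2 / 3"
  by (simp add: inner_eps zsum_eps eps_nth)

section \<open>Isotropic vectors and pairs of weights\<close>

locale wedge_representation = sl3_representation rho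
  for rho :: "real^3^3 \<Rightarrow> real^'n^'n" +
  fixes wedge :: "real^'n \<Rightarrow> real^'n \<Rightarrow> (real^'n \<Rightarrow> real)"
  assumes faithful: "faithful rho"
    and equivariant: "equivariant_wedge rho wedge"
    and nonvanishing: "\<forall>U. subspace U \<and> dim U = 2 \<longrightarrow> (\<exists>a\<in>U. \<exists>b\<in>U. wedge a b \<noteq> (\<lambda>c. 0))"
begin

lemma wedge_linear: "linear (\<lambda>a. wedge a b c)" "linear (\<lambda>b. wedge a b c)" "linear (wedge a b)"
  using equivariant by (auto simp: equivariant_wedge_def)

lemma wedge_sym: "wedge a b = wedge b a"
  using equivariant by (auto simp: equivariant_wedge_def)

lemma wedge_equivariant:
  "X \<in> sl3 \<Longrightarrow> wedge (rho X *v a) b c + wedge a (rho X *v b) c = - wedge a b (rho X *v c)"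
  using equivariant by (simp add: equivariant_wedge_def)

lemma no_isotropic_plane:
  assumes "wedge a a = (\<lambda>c. 0)" "wedge a b = (\<lambda>c. 0)" "wedge b b = (\<lambda>c. 0)" and "a \<noteq> 0"
  obtains c where "b = c *\<^sub>R a"
proof (rule ccontr)
  assume no: "\<not> thesis"
  then have "b \<notin> span {a}" using that by (auto simp: span_singleton)
  then have "independent {b, a}" "b \<noteq> a" using \<open>a \<noteq> 0\<close> by (auto simp: independent_insert span_base)
  then have "dim (span {b, a}) = 2" by (simp add: dim_eq_card_independent)
  then obtain u v where uv: "u \<in> span {b, a}" "v \<in> span {b, a}" "wedge u v \<noteq> (\<lambda>c. 0)"
    using nonvanishing by (meson subspace_span)
  have span: "\<exists>p q. u = p *\<^sub>R a + q *\<^sub>R b" if "u \<in> span {b, a}" for u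
    using that by (auto simp: span_insert span_singleton) (metis add.commute diff_add_cancel)
  obtain p q p' q' where "u = p *\<^sub>R a + q *\<^sub>R b" "v = p' *\<^sub>R a + q' *\<^sub>R b"
    using span uv(1,2) by metis
  then have "wedge u v c = 0" for c
    using assms wedge_sym[of a b]
    by (simp add: linear_add[OF wedge_linear(1)] linear_add[OF wedge_linear(2)]
        linear_scale[OF wedge_linear(1)] linear_scale[OF wedge_linear(2)] fun_eq_iff)
  then show False using uv(3) by auto
qed

text \<open>On a vector of weight \<open>z\<close>, equivariance under \<open>D t\<close> multiplies
  the value of \<open>wedge a b\<close> by \<open>(x + y + z) \<bullet> t\<close> and gives zero.
  Taking \<open>t = x + y + z\<close> turns the factor into a squared length, so only
  \<open>z = - x - y\<close> can contribute.\<close>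

lemma wedge_weight_zero:
  assumes a: "weight_vector x a" "zsum x" and b: "weight_vector y b" "zsum y" and xy: "- x - y \<notin> weights"
  shows "wedge a b = (\<lambda>c. 0)"
proof
  fix c
  have "c \<in> span {v. \<exists>x. zsum x \<and> weight_vector x v}" by (simp add: weight_spaces_span)
  then show "wedge a b c = 0"
  proof (induction rule: span_induct_alt)
    case base
    show ?case by (rule linear_0[OF wedge_linear(3)])
  next
    case (step r v v')
    then obtain z where z: "zsum z" "weight_vector z v" by blast
    have "wedge a b v = 0"
    proof (cases "x + y + z = 0")
      case True
      then have "z = - x - y" by (metis add.commute add_diff_cancel_left' diff_0 diff_diff_add)
      then have "v = 0" using xy z not_weightD by blast
      then show ?thesis using linear_0[OF wedge_linear(3)] by simp
    next
      case False
      let ?t = "x + y + z"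
      have t: "zsum ?t" using a b z by (intro zsum_arith)
      have "(x \<bullet> ?t) * wedge a b v + (y \<bullet> ?t) * wedge a b v = - ((z \<bullet> ?t) * wedge a b v)"
        using wedge_equivariant[OF D_in_sl3[OF t], of a b v]
        by (simp add: weight_vectorD[OF a(1) t] weight_vectorD[OF b(1) t] weight_vectorD[OF z(2) t]
            linear_scale[OF wedge_linear(1)] linear_scale[OF wedge_linear(2)] linear_scale[OF wedge_linear(3)])
      then have "(?t \<bullet> ?t) * wedge a b v = 0" by (simp add: inner_add_left algebra_simps)
      then show ?thesis using False by simp
    qed
    with step show ?case
      by (simp add: linear_add[OF wedge_linear(3)] linear_scale[OF wedge_linear(3)])
  qed
qed

lemma weight_multiplicity_one:
  assumes "weight_vector x u" "weight_vector x v" "zsum x" "u \<noteq> 0" "-2 *\<^sub>R x \<notin> weights"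
  obtains c where "v = c *\<^sub>R u"
proof -
  have "- x - x \<notin> weights" using assms(5) by (simp add: scaleR_2)
  then have "wedge a b = (\<lambda>c. 0)" if "a \<in> {u, v}" "b \<in> {u, v}" for a b
    using that assms wedge_weight_zero by blast
  then show thesis using no_isotropic_plane[of u v] assms(4) that by blast
qed

lemma weight_pair:
  assumes "x \<in> weights" "y \<in> weights" "x \<noteq> y"
  shows "-2 *\<^sub>R x \<in> weights \<or> -2 *\<^sub>R y \<in> weights \<or> - x - y \<in> weights"
proof (rule ccontr)
  assume "\<not> ?thesis"
  then have *: "- x - x \<notin> weights" "- y - y \<notin> weights" "- x - y \<notin> weights" by (simp_all add: scaleR_2)
  obtain u v where u: "u \<noteq> 0" "weight_vector x u" "zsum x" and v: "v \<noteq> 0" "weight_vector y v" "zsum y"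
    using assms by (auto simp: weights_def)
  have "wedge u u = (\<lambda>c. 0)" "wedge u v = (\<lambda>c. 0)" "wedge v v = (\<lambda>c. 0)"
    using wedge_weight_zero u v * by blast+
  then obtain c where c: "v = c *\<^sub>R u"
    using no_isotropic_plane[of u v] u(1) by blast
  \<comment> \<open>Proportional nonzero vectors have equal weights: \<open>D (x - y)\<close>
    detects the squared length of \<open>x - y\<close>.\<close>
  let ?t = "x - y"
  have t: "zsum ?t" using u v by (simp add: zsum_arith)
  have "(x \<bullet> ?t) *\<^sub>R v = (y \<bullet> ?t) *\<^sub>R v"
    using weight_vectorD[OF v(2) t] weight_vectorD[OF u(2) t] by (simp add: c matrix_vector_mult_scaleR)
  then have "?t \<bullet> ?t = 0" using v(1) by (simp add: inner_diff_left)
  then show False using assms(3) by simp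
qed

text \<open>If \<open>X\<close> kills \<open>X u\<close>, then an isotropic \<open>u\<close> makes the span of \<open>u\<close> and \<open>X u\<close> isotropic:
  apply \<open>X\<close> twice to \<open>wedge u u = 0\<close>.\<close>
lemma isotropic_string:
  assumes X: "X \<in> sl3" and "wedge u u = (\<lambda>c. 0)" "rho X *v (rho X *v u) = 0" "u \<noteq> 0"
  obtains c where "rho X *v u = c *\<^sub>R u"
proof -
  have 1: "wedge u (rho X *v u) c = 0" for c
    using wedge_equivariant[OF X, of u u c] wedge_sym[of u "rho X *v u"] assms(2) by simp
  have 2: "wedge (rho X *v u) (rho X *v u) c = 0" for c
    using wedge_equivariant[OF X, of u "rho X *v u" c] 1 assms(3) linear_0[OF wedge_linear(2)] by simp
  show thesis
    using 1 2 assms(2,4) no_isotropic_plane[of u "rho X *v u"] that by blast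
qed

section \<open>Longest weights and the list of all weights\<close>

definition longest :: "real^3 \<Rightarrow> bool" where
  "longest x \<longleftrightarrow> x \<in> weights \<and> x \<noteq> 0 \<and> (\<forall>y\<in>weights. y \<bullet> y \<le> x \<bullet> x)"

text \<open>By faithfulness some weight is nonzero: otherwise \<open>D (rootvec 1 2)\<close> would
  kill the weight vectors, which span.\<close>

lemma longest_exists: "\<exists>x. longest x"
proof -
  have "\<exists>y\<in>weights. y \<noteq> 0"
  proof (rule ccontr)
    assume no: "\<not> ?thesis"
    let ?D = "D (rootvec 1 2)"
    have "rho ?D *v v = 0" for v
    proof -
      have "v \<in> span {v. \<exists>x. zsum x \<and> weight_vector x v}" by (simp add: weight_spaces_span)
      then show ?thesis
      proof (induction rule: span_induct_alt)
        case (step r u u')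
        then obtain x where x: "zsum x" "weight_vector x u" by blast
        have "rho ?D *v u = 0"
        proof (cases "u = 0")
          case False
          then have "x = 0" using no x by (auto simp: weights_def)
          then show ?thesis using weight_vector_root[OF x(2), of 1 2] by simp
        qed simp
        with step show ?case by (simp add: matrix_vector_right_distrib matrix_vector_mult_scaleR)
      qed simp
    qed
    then have "rho ?D = rho 0" by (simp add: rho_zero matrix_eq)
    then have "?D = 0" using faithful D_in_sl3[OF zsum_root] sl3_arith(4) by (auto simp: faithful_def)
    then have "?D $ 1 $ 1 = 0" by simp
    then show False by (simp add: D_def root_nth)
  qed
  then obtain y where y: "y \<in> weights" "y \<noteq> 0" by blast
  let ?q = "(\<lambda>x. x \<bullet> x) ` weights"
  have fin: "finite ?q" using finite_weights by simp
  then have "Max ?q \<in> ?q" using y by (intro Max_in) auto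
  then obtain x where x: "x \<in> weights" "x \<bullet> x = Max ?q" by auto
  then have "\<forall>y\<in>weights. y \<bullet> y \<le> x \<bullet> x" using fin by auto
  moreover from this y have "x \<noteq> 0" by (metis inner_eq_zero_iff inner_ge_zero inner_zero_left order_antisym)
  ultimately show ?thesis using x by (auto simp: longest_def)
qed

lemma longestD:
  assumes "longest x"
  shows "x \<in> weights" "zsum x" "x \<bullet> x > 0" "y \<in> weights \<Longrightarrow> y \<bullet> y \<le> x \<bullet> x" "-2 *\<^sub>R x \<notin> weights"
proof -
  show *: "x \<in> weights" "zsum x" "x \<bullet> x > 0" "y \<in> weights \<Longrightarrow> y \<bullet> y \<le> x \<bullet> x" for y
    using assms by (auto simp: longest_def weights_def)
  show "-2 *\<^sub>R x \<notin> weights"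
  proof
    assume "-2 *\<^sub>R x \<in> weights"
    then have "(-2 *\<^sub>R x) \<bullet> (-2 *\<^sub>R x) \<le> x \<bullet> x" by (rule *)
    then show False using *(3) by simp
  qed
qed

text \<open>Let \<open>i\<close> be a coordinate of largest absolute value. If the other two differ,
  their exchange gives a second weight \<open>y\<close> of the same length. The vectors
  \<open>-2x\<close> and \<open>-2y\<close> are too long, and so is \<open>- x - y\<close>: its
  squared length is 6 times the square of \<open>x\<^sub>i\<close>, against at most 3 times for
  \<open>x\<close>.\<close>

lemma longest_shape:
  assumes x: "longest x"
  obtains i j k s where "i \<noteq> j" "i \<noteq> k" "j \<noteq> k" "s \<noteq> 0" "x $ i = -2 * s" "x $ j = s" "x $ k = s"
proof -
  obtain i where i: "\<And>l. \<bar>x $ l\<bar> \<le> \<bar>x $ i\<bar>"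
  proof -
    have "Max (range (\<lambda>l. \<bar>x $ l\<bar>)) \<in> range (\<lambda>l. \<bar>x $ l\<bar>)" by (intro Max_in) auto
    then obtain i where "Max (range (\<lambda>l. \<bar>x $ l\<bar>)) = \<bar>x $ i\<bar>" by (rule rangeE)
    then show thesis using that[of i] Max_ge[of "range (\<lambda>l. \<bar>x $ l\<bar>)"] by simp
  qed
  obtain j k where d: "i \<noteq> j" "i \<noteq> k" "j \<noteq> k" by (rule other_indices)
  note inner3 = inner_distinct[OF d] and xs = longestD[OF x]
  have sum: "x $ i = - (x $ j + x $ k)" using xs(2) by (simp add: zsum_distinct[OF d])
  have jk: "(x $ j)\<^sup>2 \<le> (x $ i)\<^sup>2" "(x $ k)\<^sup>2 \<le> (x $ i)\<^sup>2"
    using i by (simp_all add: abs_le_square_iff)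
  have xi: "(x $ i)\<^sup>2 > 0"
    using xs(3) jk by (auto simp: inner3 power2_eq_square)
  have "x $ j = x $ k"
  proof (rule ccontr)
    assume ne: "x $ j \<noteq> x $ k"
    define y where "y = x - (x $ j - x $ k) *\<^sub>R rootvec j k"
    have y: "y $ i = x $ i" "y $ j = x $ k" "y $ k = x $ j" using d by (auto simp: y_def root_nth)
    have yw: "y \<in> weights" unfolding y_def using xs(1) d by (intro weights_reflect)
    have "y \<noteq> x" using y(2) ne by metis
    then consider "-2 *\<^sub>R x \<in> weights" | "-2 *\<^sub>R y \<in> weights" | "- x - y \<in> weights"
      using weight_pair[OF xs(1) yw] by metis
    then show False
    proof cases
      case 1
      then show ?thesis using xs(5) by blast
    next
      case 2
      have "(-2 *\<^sub>R y) \<bullet> (-2 *\<^sub>R y) = 4 * (x \<bullet> x)"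
        unfolding inner3 by (simp only: vector_scaleR_component y) (simp add: algebra_simps)
      then show ?thesis using xs(3) xs(4)[OF 2] by simp
    next
      case 3
      have "(- x - y) \<bullet> (- x - y) = 6 * (x $ i)\<^sup>2"
        unfolding inner3 by (simp only: vector_minus_component vector_uminus_component y sum)
          (simp add: power2_eq_square algebra_simps)
      then show ?thesis using xs(4)[OF 3] jk xi by (simp add: inner3 power2_eq_square)
    qed
  qed
  then have eq: "x $ i = -2 * x $ j" "x $ k = x $ j" using sum by simp_all
  moreover have "x $ j \<noteq> 0" using xi eq(1) by auto
  ultimately show thesis using that[OF d] by blast
qed

text \<open>The neighbour \<open>y = x + rootvec i j\<close> is a weight, so \<open>-2y\<close> or
  \<open>- x - y\<close> is one. The length bound then says that a square is at most zero, which
  leaves \<open>s = 2/3\<close> or \<open>s = 1/3\<close> respectively. The second value is excluded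
  by an isotropic string.\<close>

lemma longest_is_minus_two_eps:
  assumes x: "longest x" and d: "i \<noteq> j" "i \<noteq> k" "j \<noteq> k" and s: "s > 0"
    and xc: "x $ i = -2 * s" "x $ j = s" "x $ k = s"
  shows "x = -2 *\<^sub>R eps i"
proof -
  note inner3 = inner_distinct[OF d] and xs = longestD[OF x]
  obtain u where u: "u \<noteq> 0" "weight_vector x u" using xs(1) by (auto simp: weights_def)
  have int: "3 * s \<in> \<int>" using weight_integral[OF xs(1) d(1)[symmetric]] xc by simp
  let ?v = "rho (E i j) *v u" and ?y = "x + rootvec i j"
  have v: "?v \<noteq> 0"
    using d s xc xs(2) u by (intro weight_lower) auto
  have wv: "weight_vector ?y ?v" using d u by (intro weight_vector_E)
  have yz: "zsum ?y" using xs(2) zsum_root zsum_arith by blast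
  have yw: "?y \<in> weights" using v wv yz by (auto simp: weights_def)
  have y: "?y $ i = 1 - 2 * s" "?y $ j = s - 1" "?y $ k = s" using d xc by (auto simp: root_nth)
  have "?y \<noteq> x" using y(1) xc(1) by auto
  then consider "-2 *\<^sub>R ?y \<in> weights" | "- x - ?y \<in> weights"
    using weight_pair[OF xs(1) yw] xs(5) by metis
  then have "s = 2 / 3"
  proof cases
    case 1
    have "(-2 *\<^sub>R ?y) \<bullet> (-2 *\<^sub>R ?y) = 24 * s\<^sup>2 - 24 * s + 8"
      unfolding inner3 by (simp only: vector_scaleR_component y) (simp add: power2_eq_square algebra_simps)
    moreover have "x \<bullet> x = 6 * s\<^sup>2" unfolding inner3 xc by (simp add: power2_eq_square)
    ultimately have "2 * (3 * s - 2)\<^sup>2 \<le> 0" using xs(4)[OF 1] by (simp add: power2_eq_square algebra_simps)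
    then show ?thesis by simp
  next
    case 2
    have "(- x - ?y) \<bullet> (- x - ?y) = 24 * s\<^sup>2 - 12 * s + 2"
      unfolding inner3 by (simp only: vector_minus_component vector_uminus_component y xc)
        (simp add: power2_eq_square algebra_simps)
    moreover have xx: "x \<bullet> x = 6 * s\<^sup>2" unfolding inner3 xc by (simp add: power2_eq_square)
    ultimately have "2 * (3 * s - 1)\<^sup>2 \<le> 0" using xs(4)[OF 2] by (simp add: power2_eq_square algebra_simps)
    \<comment> \<open>Here \<open>x\<close> would be \<open>- eps i\<close>. Adding the root twice
      leaves the ball, so \<open>E i j\<close> kills \<open>?v\<close>; the plane of
      \<open>u\<close> and \<open>?v\<close> would be isotropic, although they have different
      weights.\<close>
    then have s3: "s = 1 / 3" by simp
    let ?z = "?y + rootvec i j"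
    have z: "?z $ i = 2 - 2 * s" "?z $ j = s - 2" "?z $ k = s" using d xc by (auto simp: root_nth)
    have "?z \<bullet> ?z > x \<bullet> x"
      unfolding xx unfolding inner3 by (simp only: z) (simp add: s3 power2_eq_square)
    then have "?z \<notin> weights" using xs(4)[of ?z] by auto
    moreover have "zsum ?z" using yz zsum_root zsum_arith by blast
    moreover have "weight_vector ?z (rho (E i j) *v ?v)" by (rule weight_vector_E[OF d(1) wv])
    ultimately have "rho (E i j) *v ?v = 0" by (intro not_weightD)
    moreover have "- x - x \<notin> weights" using xs(5) by (simp add: scaleR_2)
    then have "wedge u u = (\<lambda>c. 0)" using u xs(2) by (intro wedge_weight_zero)
    ultimately obtain c where c: "?v = c *\<^sub>R u"
      using isotropic_string[OF E_in_sl3[OF d(1)]] u(1) by metis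
    have "weight_vector x ?v" unfolding c using u(2) by (simp add: weight_vector_def matrix_vector_mult_scaleR)
    from weight_vector_root[OF this, of i j] weight_vector_root[OF wv, of i j] v
    have "x $ i - x $ j = ?y $ i - ?y $ j" by (metis scaleR_cancel_right)
    then show ?thesis using y xc by simp
  qed
  then show ?thesis unfolding vec_eq_distinct[OF d] using d xc by (simp add: eps_nth)
qed

text \<open>Reflections produce all \<open>-2 eps a\<close>. Pairing any other weight
  \<open>z\<close> with each of them bounds its length by that of \<open>eps a\<close>; integrality
  leaves 0 and the vectors \<open>eps a\<close> and \<open>- eps a\<close>.\<close>

lemma weights_classification:
  assumes x: "longest x" and xi: "x = -2 *\<^sub>R eps i"
  shows "-2 *\<^sub>R eps a \<in> weights"
    and "z \<in> weights \<Longrightarrow> z = 0 \<or> (\<exists>a. z = eps a) \<or> (\<exists>a. z = -2 *\<^sub>R eps a)"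
proof -
  note xs = longestD[OF x]
  have xx: "x \<bullet> x = 8 / 3" by (simp add: xi eps_inner_eps)
  have norm: "y \<bullet> y \<le> 8 / 3" if "y \<in> weights" for y using xs(4)[OF that] xx by simp
  show eps: "-2 *\<^sub>R eps a \<in> weights" for a
  proof (cases "a = i")
    case False
    have "x - (x $ i - x $ a) *\<^sub>R rootvec i a \<in> weights" using xs(1) False by (intro weights_reflect) auto
    moreover have "x - (x $ i - x $ a) *\<^sub>R rootvec i a = -2 *\<^sub>R eps a"
      using False by (auto simp: vec_eq_iff xi eps_nth root_nth)
    ultimately show ?thesis by simp
  qed (use xs xi in simp)
  have four: "-2 *\<^sub>R -2 *\<^sub>R eps a \<notin> weights" for a
    using norm[of "-2 *\<^sub>R -2 *\<^sub>R eps a"] by (auto simp: eps_inner_eps)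
  have two: "2 *\<^sub>R eps a \<notin> weights" for a
  proof
    assume w: "2 *\<^sub>R eps a \<in> weights"
    obtain b c where d: "a \<noteq> b" "a \<noteq> c" "b \<noteq> c" by (rule other_indices)
    \<comment> \<open>Twice the root \<open>rootvec b a\<close>, of squared length 8.\<close>
    let ?y = "- (2 *\<^sub>R eps a) - (-2 *\<^sub>R eps b)"
    have "2 *\<^sub>R eps a \<noteq> -2 *\<^sub>R eps b" using d by (auto simp: vec_eq_distinct[OF d] eps_nth)
    moreover have "-2 *\<^sub>R 2 *\<^sub>R eps a \<notin> weights"
      using norm[of "-2 *\<^sub>R 2 *\<^sub>R eps a"] by (auto simp: eps_inner_eps)
    ultimately have "?y \<in> weights" using weight_pair[OF w eps] four by blast
    then have "?y \<bullet> ?y \<le> 8 / 3" by (rule norm)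
    then show False using d by (simp add: inner_distinct[OF d] eps_nth)
  qed
  assume z: "z \<in> weights"
  then have zz: "zsum z" by (auto simp: weights_def)
  have pair: "-2 *\<^sub>R z \<in> weights \<or> 2 *\<^sub>R eps a - z \<in> weights" if "z \<noteq> -2 *\<^sub>R eps a" for a
    using weight_pair[OF eps z that[symmetric]] four by auto
  show "z = 0 \<or> (\<exists>a. z = eps a) \<or> (\<exists>a. z = -2 *\<^sub>R eps a)"
  proof (cases "\<exists>a. z = -2 *\<^sub>R eps a")
    case False
    have small: "z \<bullet> z \<le> 2 / 3"
    proof (cases "-2 *\<^sub>R z \<in> weights")
      case True
      then show ?thesis using norm[of "-2 *\<^sub>R z"] by simp
    next
      case notw: False
      have "z \<bullet> z \<le> 4 * z $ a" for a
      proof -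
        have "2 *\<^sub>R eps a - z \<in> weights" using pair False notw by blast
        then have "(2 *\<^sub>R eps a - z) \<bullet> (2 *\<^sub>R eps a - z) \<le> 8 / 3" by (rule norm)
        then show ?thesis
          by (simp add: inner_diff_left inner_diff_right eps_inner_eps inner_eps zz inner_commute[of "eps a" z])
      qed
      \<comment> \<open>The right sides add up to zero, so in this case even
        \<open>z \<bullet> z \<le> 0\<close>.\<close>
      from this[of 1] this[of 2] this[of 3] zz show ?thesis by (simp add: zsum_def)
    qed
    have "z $ 1 - z $ 2 \<in> \<int>" "z $ 2 - z $ 3 \<in> \<int>" using z by (auto intro: weight_integral)
    \<comment> \<open>The coordinates of \<open>z\<close> with respect to the fundamental weights
      \<open>eps 1\<close> and \<open>- eps 3\<close>.\<close>
    then obtain m n :: int where mn: "z $ 1 - z $ 2 = of_int m" "z $ 2 - z $ 3 = of_int n"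
      by (metis Ints_cases)
    have z3: "z $ 1 = (2 * of_int m + of_int n) / 3" "z $ 2 = (of_int n - of_int m) / 3"
      "z $ 3 = - (of_int m + 2 * of_int n) / 3"
      using mn zz by (simp_all add: zsum_def)
    have "z \<bullet> z = 2 / 3 * of_int (m\<^sup>2 + m * n + n\<^sup>2)"
      by (simp add: inner_vec_def sum_3 z3 power2_eq_square field_simps)
    then have "of_int (m\<^sup>2 + m * n + n\<^sup>2) \<le> (1 :: real)" using small by simp
    then have le1: "m\<^sup>2 + m * n + n\<^sup>2 \<le> 1" by linarith
    have "4 * (m\<^sup>2 + m * n + n\<^sup>2) = (2 * m + n)\<^sup>2 + 3 * n\<^sup>2"
      "4 * (m\<^sup>2 + m * n + n\<^sup>2) = (2 * n + m)\<^sup>2 + 3 * m\<^sup>2"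
      by (simp_all add: power2_eq_square algebra_simps)
    then have "3 * m\<^sup>2 \<le> 4" "3 * n\<^sup>2 \<le> 4" using le1 by (smt (verit) zero_le_power2)+
    then have "m\<^sup>2 < 2\<^sup>2" "n\<^sup>2 < 2\<^sup>2" by simp_all
    then have "\<bar>m\<bar> < 2" "\<bar>n\<bar> < 2" by (metis abs_numeral abs_le_square_iff not_le)+
    then have "m \<in> {-1, 0, 1}" "n \<in> {-1, 0, 1}" by auto
    \<comment> \<open>The origin and the six shortest vectors of the hexagonal weight
      lattice.\<close>
    then have "(m, n) \<in> {(0, 0), (1, 0), (0, 1), (1, -1), (-1, 1), (-1, 0), (0, -1)}"
      using le1 by auto
    moreover have "z = of_int m *\<^sub>R eps 1 - of_int n *\<^sub>R eps 3"
      unfolding vec_eq_iff forall_3 by (simp add: eps_nth z3 field_simps)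
    moreover have "eps 2 = - eps 1 - eps 3"
      unfolding vec_eq_iff forall_3 by (simp add: eps_nth)
    ultimately have "z \<in> {0, eps 1, eps 2, eps 3, - eps 1, - eps 2, - eps 3}"
      by (elim insertE emptyE) simp_all
    then have "z = 0 \<or> (\<exists>a. z = eps a) \<or> (\<exists>a. z = - eps a)" by blast
    \<comment> \<open>Pairing \<open>- eps a\<close> with \<open>-2 eps a\<close> would require the
      weight \<open>2 eps a\<close>, excluded above, or \<open>3 eps a\<close>, which is too
      long.\<close>
    moreover have "z \<noteq> - eps a" for a
    proof
      assume za: "z = - eps a"
      then have "-2 *\<^sub>R z = 2 *\<^sub>R eps a" "2 *\<^sub>R eps a - z = 3 *\<^sub>R eps a"
        by (simp_all add: vec_eq_iff)
      then have "3 *\<^sub>R eps a \<in> weights" using pair[of a] False two by metis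
      then show False using norm[of "3 *\<^sub>R eps a"] by (simp add: eps_inner_eps)
    qed
    ultimately show ?thesis by blast
  qed blast
qed

end

section \<open>The constituents \<open>Sym\<^sub>2(E\<^sup>*)\<close>, \<open>E\<close> and \<open>T\<close>\<close>

lemma rootvec_eps: "rootvec i j = eps i - eps j"
  by (simp add: vec_eq_iff root_nth eps_nth)

lemma matrix_vector_mult_uminus: "(- A) *v x = - (A *v x)" for A :: "real^'m^'n"
  using matrix_vector_mult_diff_rdistrib[of 0 A x] by simp

lemma matrix_mult_uminus: "A ** (- B) = - (A ** B)" "(- A) ** B = - (A ** B)" for A B :: "real^'n^'n"
  using matrix_mult_linear(1)[of A 0 B] matrix_mult_linear(2)[of 0 A B] by simp_all

text \<open>Coefficients are extended by zero beyond \<open>n\<close>, to match the sequences in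
  \<open>model_carrier\<close>.\<close>

lemma subspace_indexed_basis:
  fixes V :: "'a::euclidean_space set"
  assumes V: "subspace V"
  obtains n :: nat and b where "\<And>i. i < n \<Longrightarrow> b i \<in> V"
    and "\<And>v. v \<in> V \<Longrightarrow> \<exists>c. (\<forall>i\<ge>n. c i = 0) \<and> v = (\<Sum>i<n. c i *\<^sub>R b i)"
    and "\<And>c. (\<Sum>i<n. c i *\<^sub>R b i) = 0 \<Longrightarrow> \<forall>i<n. c i = 0"
proof -
  obtain B where B: "B \<subseteq> V" "independent B" "V \<subseteq> span B" by (rule basis_exists[of V])
  then have fin: "finite B" by (simp add: independent_imp_finite)
  then obtain b where b: "bij_betw b {..<card B} B"
    using ex_bij_betw_nat_finite[of B] by (auto simp: atLeast0LessThan)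
  have reindex: "(\<Sum>i<card B. g (b i)) = (\<Sum>x\<in>B. g x)" for g :: "'a \<Rightarrow> 'a"
    using b by (rule sum.reindex_bij_betw)
  show thesis
  proof (rule that)
    show "b i \<in> V" if "i < card B" for i using B(1) b that by (auto simp: bij_betw_def)
    show "\<exists>c. (\<forall>i\<ge>card B. c i = 0) \<and> v = (\<Sum>i<card B. c i *\<^sub>R b i)" if "v \<in> V" for v
    proof -
      have "v \<in> range (\<lambda>r. \<Sum>x\<in>B. r x *\<^sub>R x)"
        using B(3) that by (auto simp flip: span_finite[OF fin])
      then obtain r where "v = (\<Sum>x\<in>B. r x *\<^sub>R x)" by (rule rangeE)
      then have "v = (\<Sum>i<card B. (if i < card B then r (b i) else 0) *\<^sub>R b i)"
        by (simp flip: reindex)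
      then show ?thesis by (intro exI[of _ "\<lambda>i. if i < card B then r (b i) else 0"]) simp
    qed
    show "\<forall>i<card B. c i = 0" if "(\<Sum>i<card B. c i *\<^sub>R b i) = 0" for c
    proof -
      let ?inv = "the_inv_into {..<card B} b"
      have inv: "?inv (b i) = i" if "i < card B" for i
        using b that by (simp add: bij_betw_def the_inv_into_f_f)
      have "(\<Sum>x\<in>B. c (?inv x) *\<^sub>R x) = (\<Sum>i<card B. c (?inv (b i)) *\<^sub>R b i)"
        by (simp flip: reindex)
      also have "\<dots> = 0" using that by (simp add: inv)
      finally have "\<forall>x\<in>B. c (?inv x) = 0"
        using independentD[OF B(2) fin subset_refl, of "\<lambda>x. c (?inv x)"] by blast
      then show ?thesis using b inv by (metis bij_betwE lessThan_iff)
    qed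
  qed
qed

text \<open>A representation with the weights of \<open>Sym\<^sub>2(E\<^sup>*) \<oplus> E\<^sup>k \<oplus> T\<^sup>m\<close>, with a chosen lowest weight vector.\<close>
locale sym_type_representation = sl3_representation rho
  for rho :: "real^3^3 \<Rightarrow> real^'n^'n" +
  fixes u :: "real^'n"
  assumes weight_cases: "z \<in> weights \<Longrightarrow> z = 0 \<or> (\<exists>a. z = eps a) \<or> (\<exists>a. z = -2 *\<^sub>R eps a)"
    and multiplicity_one: "weight_vector (-2 *\<^sub>R eps a) v \<Longrightarrow> weight_vector (-2 *\<^sub>R eps a) v' \<Longrightarrow> v \<noteq> 0
      \<Longrightarrow> \<exists>c. v' = c *\<^sub>R v"
    and u: "u \<noteq> 0" "weight_vector (-2 *\<^sub>R eps 1) u"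
begin

abbreviation e :: "3 \<Rightarrow> 3 \<Rightarrow> real^'n \<Rightarrow> real^'n" where
  "e i j v \<equiv> rho (E i j) *v v"

lemmas lin = matrix_vector_right_distrib matrix_vector_mult_scaleR matrix_vector_mult_diff_distrib
  linear_neg[OF matrix_vector_mul_linear]

lemma weight_coord_le: "z \<in> weights \<Longrightarrow> z $ a \<le> 2 / 3"
  by (drule weight_cases) (auto simp: eps_nth)

text \<open>No coordinate of an admissible weight exceeds 2/3, and \<open>E a b\<close> raises the
  coordinate \<open>a\<close> by 1.\<close>

lemma E_kills:
  assumes "a \<noteq> b" "weight_vector x v" "zsum x" "x $ a > - 1 / 3"
  shows "e a b v = 0"
proof (rule not_weightD)
  show "weight_vector (x + rootvec a b) (e a b v)" using assms(1,2) by (rule weight_vector_E)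
  show "zsum (x + rootvec a b)" using assms(3) zsum_root by (rule zsum_arith)
  show "x + rootvec a b \<notin> weights"
    using weight_coord_le[of "x + rootvec a b" a] assms(1,4) by (auto simp: root_nth)
qed

lemma E_commute:
  assumes "a \<noteq> b" "c \<noteq> d"
  shows "e a b (e c d v) = e c d (e a b v) + rho ((if b = c then E a d else 0) - (if d = a then E c b else 0)) *v v"
  using rho_bracket[OF E_in_sl3[OF assms(1)] E_in_sl3[OF assms(2)]] by (simp add: E_mult)

lemma rho_expand:
  assumes X: "X \<in> sl3" and v: "weight_vector x v"
  shows "rho X *v v = (x $ 1 * X $ 1 $ 1 + x $ 2 * X $ 2 $ 2 + x $ 3 * X $ 3 $ 3) *\<^sub>R v
    + X $ 1 $ 2 *\<^sub>R e 1 2 v + X $ 1 $ 3 *\<^sub>R e 1 3 v + X $ 2 $ 1 *\<^sub>R e 2 1 v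
    + X $ 2 $ 3 *\<^sub>R e 2 3 v + X $ 3 $ 1 *\<^sub>R e 3 1 v + X $ 3 $ 2 *\<^sub>R e 3 2 v"
proof -
  define d where "d = (\<chi> i. X $ i $ i)"
  have d: "zsum d" using X by (simp add: zsum_def d_def sl3_def trace_def sum_3)
  have sl: "D d \<in> sl3" "E 1 2 \<in> sl3" "E 1 3 \<in> sl3" "E 2 1 \<in> sl3" "E 2 3 \<in> sl3" "E 3 1 \<in> sl3" "E 3 2 \<in> sl3"
    using d by (simp_all add: D_in_sl3 E_in_sl3)
  have X_eq: "X = D d + X $ 1 $ 2 *\<^sub>R E 1 2 + X $ 1 $ 3 *\<^sub>R E 1 3 + X $ 2 $ 1 *\<^sub>R E 2 1
    + X $ 2 $ 3 *\<^sub>R E 2 3 + X $ 3 $ 1 *\<^sub>R E 3 1 + X $ 3 $ 2 *\<^sub>R E 3 2"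
    unfolding vec_eq_iff forall_3 by (simp add: D_def E_def d_def)
  have "rho X = rho (D d) + X $ 1 $ 2 *\<^sub>R rho (E 1 2) + X $ 1 $ 3 *\<^sub>R rho (E 1 3) + X $ 2 $ 1 *\<^sub>R rho (E 2 1)
    + X $ 2 $ 3 *\<^sub>R rho (E 2 3) + X $ 3 $ 1 *\<^sub>R rho (E 3 1) + X $ 3 $ 2 *\<^sub>R rho (E 3 2)"
    by (subst X_eq) (simp add: sl rho_add rho_scale sl3_arith)
  then show ?thesis
    using weight_vectorD[OF v d]
    by (simp add: matrix_vector_mult_add_rdistrib inner_vec_def sum_3 d_def flip: scaleR_matrix_vector_assoc)
qed

section \<open>The copy of the quadratic forms on E generated by \<open>u\<close>\<close>

text \<open>Plays the product of the \<open>i\<close>-th and \<open>j\<close>-th coordinate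
  functions on E, with \<open>u\<close> as the square of the first. The factors arise because
  \<open>E 1 j\<close> sends the first coordinate function to minus the \<open>j\<close>-th.\<close>

definition q :: "3 \<Rightarrow> 3 \<Rightarrow> real^'n" where
  "q i j = (if i = 1 then if j = 1 then u else (- 1 / 2) *\<^sub>R e 1 j u
    else if j = 1 then (- 1 / 2) *\<^sub>R e 1 i u else (1 / 2) *\<^sub>R e 1 i (e 1 j u))"

lemma q_sym: "q i j = q j i"
  by (auto simp: q_def E_commute[of 1 i 1 j] rho_zero)

lemma weight_vector_scale: "weight_vector x v \<Longrightarrow> weight_vector x (c *\<^sub>R v)"
  by (simp add: weight_vector_def matrix_vector_mult_scaleR)

lemma weight_vector_q: "weight_vector (- eps i - eps j) (q i j)"
proof -
  have *: "- 2 *\<^sub>R eps 1 + rootvec 1 l = - eps 1 - eps l" for l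
    by (simp add: rootvec_eps vec_eq_iff)
  have 1: "weight_vector (- eps 1 - eps l) (e 1 l u)" if "l \<noteq> 1" for l
    using weight_vector_E[of 1 l, OF _ u(2)] that by (simp only: *)
  have **: "- eps 1 - eps l + rootvec 1 m = - eps m - eps l" for l m
    by (simp add: rootvec_eps)
  have 2: "weight_vector (- eps m - eps l) (e 1 m (e 1 l u))" if "l \<noteq> 1" "m \<noteq> 1" for l m
    using weight_vector_E[OF that(2)[symmetric] 1[OF that(1)]] by (simp only: **)
  have 0: "- eps 1 - eps 1 = -2 *\<^sub>R eps 1" by (simp add: scaleR_2)
  have 11: "weight_vector (- eps 1 - eps 1) (q 1 1)" unfolding 0 q_def using u(2) by simp
  have 12: "weight_vector (- eps 1 - eps l) (q 1 l)" if "l \<noteq> 1" for l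
    using weight_vector_scale[OF 1[OF that], of "- 1 / 2"] that by (simp add: q_def)
  have 21: "weight_vector (- eps l - eps 1) (q l 1)" if "l \<noteq> 1" for l
    using 12[OF that] unfolding q_sym[of 1 l] minus_diff_commute[of "eps 1"] .
  have 22: "weight_vector (- eps m - eps l) (q m l)" if "l \<noteq> 1" "m \<noteq> 1" for l m
    using 2[OF that] that unfolding q_def by (simp only: weight_vector_scale if_True if_False)
  show ?thesis
    using 11 12 21 22 by (cases "i = 1"; cases "j = 1") auto
qed

lemma zsum_q: "zsum (- eps i - eps j)"
  by (intro zsum_arith zsum_eps)

text \<open>For \<open>a \<noteq> 1\<close> the weight of \<open>u\<close> has coordinate difference
  2 between \<open>a\<close> and 1, so \<open>weight_E_pow\<close> applies to the square of
  \<open>E 1 a\<close>.\<close>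

lemma q_nonzero: "q a a \<noteq> 0"
proof (cases "a = 1")
  case False
  have "((*v) (rho (E 1 a)) ^^ 2) u \<noteq> 0"
    using False u by (intro weight_E_pow[where x = "-2 *\<^sub>R eps 1"]) (auto simp: eps_nth)
  then show ?thesis using False by (simp add: q_def numeral_2_eq_2)
qed (simp add: q_def u)

lemma e_q:
  assumes "j \<noteq> 1"
  shows "e 1 j (q 1 1) = -2 *\<^sub>R q 1 j" "l \<noteq> 1 \<Longrightarrow> e 1 j (q 1 l) = - q j l"
    "l \<noteq> 1 \<Longrightarrow> m \<noteq> 1 \<Longrightarrow> e 1 j (q l m) = 0"
proof -
  show "e 1 j (q 1 1) = -2 *\<^sub>R q 1 j" "l \<noteq> 1 \<Longrightarrow> e 1 j (q 1 l) = - q j l"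
    using assms by (auto simp: q_def lin)
  show "e 1 j (q l m) = 0" if "l \<noteq> 1" "m \<noteq> 1"
    using assms that by (intro E_kills[OF _ weight_vector_q zsum_q]) (auto simp: eps_nth)
qed

lemma mult_E_component:
  fixes X :: "real^3^3"
  shows "(X ** E i j) $ a $ b = (if b = j then X $ a $ i else 0)"
    and "(E i j ** X) $ a $ b = (if a = i then X $ j $ b else 0)"
  by (simp_all add: E_def matrix_matrix_mult_def if_distrib[of "\<lambda>x. _ * x"] if_distrib[of "\<lambda>x. x * _"]
      cong: if_cong)

text \<open>The action on products of coordinate functions. On \<open>q 1 1\<close> it follows from
  the weights; commuting \<open>X\<close> past \<open>E 1 m\<close> carries it to
  \<open>q 1 m\<close> and then to the remaining \<open>q k m\<close>.\<close>

lemma rho_q: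
  assumes X: "X \<in> sl3"
  shows "rho X *v q i j = - (\<Sum>l\<in>UNIV. X $ i $ l *\<^sub>R q l j + X $ j $ l *\<^sub>R q i l)"
proof -
  have tr: "Y $ 1 $ 1 + Y $ 2 $ 2 + Y $ 3 $ 3 = 0" if "Y \<in> sl3" for Y
    using that by (simp add: sl3_def trace_def sum_3)
  have 11: "rho Y *v q 1 1 = -2 *\<^sub>R (\<Sum>l\<in>UNIV. Y $ 1 $ l *\<^sub>R q 1 l)" if Y: "Y \<in> sl3" for Y
  proof -
    have "e a b u = 0" if "a \<noteq> b" "a \<noteq> 1" for a b
      using that by (intro E_kills[OF _ u(2) zsum_arith(3)[OF zsum_eps]]) (auto simp: eps_nth)
    moreover have "(-2 *\<^sub>R eps 1) $ 1 * Y $ 1 $ 1 + (-2 *\<^sub>R eps 1) $ 2 * Y $ 2 $ 2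
        + (-2 *\<^sub>R eps 1) $ 3 * Y $ 3 $ 3 = -2 * Y $ 1 $ 1"
      using tr[OF Y] by (simp add: eps_nth)
    ultimately have "rho Y *v u = (-2 * Y $ 1 $ 1) *\<^sub>R u + Y $ 1 $ 2 *\<^sub>R e 1 2 u + Y $ 1 $ 3 *\<^sub>R e 1 3 u"
      unfolding rho_expand[OF Y u(2)] by simp
    then show ?thesis by (simp add: q_def sum_3 algebra_simps)
  qed
  have 1: "rho Y *v q 1 m = - (\<Sum>l\<in>UNIV. Y $ 1 $ l *\<^sub>R q l m + Y $ m $ l *\<^sub>R q 1 l)"
    if Y: "Y \<in> sl3" for Y m
  proof (cases "m = 1")
    case True
    then show ?thesis by (simp add: 11[OF Y] sum_3 q_sym[of 2 1] q_sym[of 3 1] q_sym[of 3 2] vec_eq_iff algebra_simps)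
  next
    case False
    \<comment> \<open>This commutator lies in \<open>sl3\<close>, so the formula for
      \<open>q 1 1\<close>, proved for every \<open>Y\<close>, covers it.\<close>
    let ?B = "Y ** E 1 m - E 1 m ** Y"
    have "rho Y *v q 1 m = (- 1 / 2) *\<^sub>R (rho Y *v e 1 m (q 1 1))"
      using False by (simp add: e_q lin)
    also have "rho Y *v e 1 m (q 1 1) = e 1 m (rho Y *v q 1 1) + rho ?B *v q 1 1"
      using False by (intro rho_bracket Y E_in_sl3) auto
    also have "\<dots> = -2 *\<^sub>R (\<Sum>l\<in>UNIV. Y $ 1 $ l *\<^sub>R e 1 m (q 1 l)) -2 *\<^sub>R (\<Sum>l\<in>UNIV. ?B $ 1 $ l *\<^sub>R q 1 l)"
      unfolding 11[OF Y] 11[OF commutator_in_sl3] by (simp add: sum_3 lin)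
    finally show ?thesis
      using False exhaust_3[of m]
      by (elim disjE) (simp_all add: sum_3 e_q mult_E_component q_sym[of 2 1] q_sym[of 3 1] q_sym[of 3 2] vec_eq_iff algebra_simps)
  qed
  have 2: "rho X *v q k m = - (\<Sum>l\<in>UNIV. X $ k $ l *\<^sub>R q l m + X $ m $ l *\<^sub>R q k l)"
    if km: "k \<noteq> 1" "m \<noteq> 1" for k m
  proof -
    let ?B = "X ** E 1 k - E 1 k ** X"
    have "rho X *v q k m = - (rho X *v e 1 k (q 1 m))"
      using km by (simp add: e_q lin)
    also have "rho X *v e 1 k (q 1 m) = e 1 k (rho X *v q 1 m) + rho ?B *v q 1 m"
      using km by (intro rho_bracket X E_in_sl3) auto
    also have "\<dots> = - (\<Sum>l\<in>UNIV. X $ 1 $ l *\<^sub>R e 1 k (q l m) + X $ m $ l *\<^sub>R e 1 k (q 1 l))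
      - (\<Sum>l\<in>UNIV. ?B $ 1 $ l *\<^sub>R q l m + ?B $ m $ l *\<^sub>R q 1 l)"
      unfolding 1[OF X] 1[OF commutator_in_sl3] by (simp add: sum_3 lin)
    finally show ?thesis
      using km exhaust_3[of m] exhaust_3[of k]
      by (elim disjE) (simp_all add: sum_3 e_q mult_E_component q_sym[of 2 1] q_sym[of 3 1] q_sym[of 3 2] vec_eq_iff algebra_simps)
  qed
  show ?thesis
  proof (cases "i = 1")
    case True
    then show ?thesis using 1[OF X] by simp
  next
    case i: False
    show ?thesis
    proof (cases "j = 1")
      case True
      then show ?thesis using 1[OF X, of i]
        by (simp add: q_sym[of i] sum_3 q_sym[of 2 1] q_sym[of 3 1] add.commute)
    next
      case False
      with i show ?thesis by (rule 2)
    qed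
  qed
qed

section \<open>Copies of E and the trivial part\<close>

text \<open>The vector \<open>q 2 3\<close> has weight \<open>eps 1\<close> as well; the two
  annihilation conditions separate the highest weight vectors of copies of E from it.\<close>

definition K :: "(real^'n) set" where
  "K = {v. weight_vector (eps 1) v \<and> e 2 3 v = 0 \<and> e 3 2 v = 0}"

lemma subspace_K: "subspace K"
  by (auto simp: K_def subspace_def weight_vector_def lin algebra_simps)

text \<open>For the sl_2 of the indices \<open>a\<close> and \<open>b\<close> the vector has weight
  0, and a highest weight vector of weight 0 is also killed by the lowering operator.\<close>

lemma K_intro:
  assumes v: "weight_vector (eps 1) v" and ab: "a \<noteq> b" "a \<noteq> 1" "b \<noteq> 1" and "e a b v = 0"
  shows "v \<in> K"
proof -
  have "rho (D (rootvec a b)) *v v = real 0 *\<^sub>R v"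
    using weight_vector_root[OF v, of a b] ab by (simp add: eps_nth)
  then have "((*v) (rho (E b a)) ^^ Suc 0) v = 0"
    using assms(5) by (intro sl2_module.fpow_highest_weight_vector[OF sl2_module[OF ab(1)]])
  then show ?thesis
    using assms exhaust_3[of a] exhaust_3[of b] by (auto simp: K_def)
qed

text \<open>The \<open>a\<close>-th standard basis vector in the copy of E whose first basis vector
  is \<open>v\<close>.\<close>

definition \<kappa> :: "3 \<Rightarrow> real^'n \<Rightarrow> real^'n" where
  "\<kappa> a v = (if a = 1 then v else e a 1 v)"

lemma linear_\<kappa>: "linear (\<kappa> a)"
  by (cases "a = 1") (simp_all add: \<kappa>_def linear_iff lin)

lemma weight_vector_\<kappa>:
  assumes "v \<in> K"
  shows "weight_vector (eps a) (\<kappa> a v)"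
proof (cases "a = 1")
  case False
  have "weight_vector (eps 1 + rootvec a 1) (e a 1 v)"
    using assms False by (intro weight_vector_E) (auto simp: K_def)
  then show ?thesis using False by (simp add: rootvec_eps \<kappa>_def)
qed (use assms in \<open>simp add: \<kappa>_def K_def\<close>)

text \<open>For \<open>a = l\<close> the resulting weight is too large. Otherwise the result has
  weight \<open>-2 eps 1\<close>, on which \<open>E 1 l\<close> is injective by
  \<open>weight_lower\<close>, while commutators show that \<open>E 1 l\<close> kills it.\<close>

lemma e_\<kappa>_zero:
  assumes v: "v \<in> K" and "a \<noteq> 1" "l \<noteq> 1"
  shows "e a 1 (\<kappa> l v) = 0"
proof (cases "a = l")
  case True
  then show ?thesis
    using assms by (intro E_kills[OF _ weight_vector_\<kappa>[OF v] zsum_eps]) (auto simp: eps_nth)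
next
  case False
  let ?y = "e a 1 (e l 1 v)"
  have vw: "weight_vector (eps 1) v" and van: "e l a v = 0" "e a l v = 0"
    using v assms False exhaust_3[of a] exhaust_3[of l] by (auto simp: K_def)
  have "eps l + rootvec a 1 = -2 *\<^sub>R eps 1"
    using assms False exhaust_3[of a] exhaust_3[of l] by (auto simp: vec_eq_iff eps_nth root_nth forall_3)
  then have y: "weight_vector (-2 *\<^sub>R eps 1) ?y"
    using weight_vector_E[OF assms(2) weight_vector_\<kappa>[OF v, of l]] assms(3) by (simp add: \<kappa>_def)
  have "e 1 l v = 0" using assms by (intro E_kills[OF _ vw zsum_eps]) (auto simp: eps_nth)
  moreover have "rho (D (rootvec 1 l)) *v v = v"
    using weight_vector_root[OF vw, of 1 l] assms by (simp add: eps_nth)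
  ultimately have "e 1 l (e l 1 v) = v"
    using E_commute[of 1 l l 1 v] assms by (simp add: E_diff_eq_D)
  \<comment> \<open>Moving \<open>e 1 l\<close> inwards gives
    \<open>e a 1 v - e a l (e l 1 v)\<close>, and the last term equals \<open>e a 1 v\<close>
    because \<open>e a l\<close> kills \<open>v\<close>.\<close>
  then have "e 1 l ?y = 0"
    using E_commute[of 1 l a 1 "e l 1 v"] E_commute[of a l l 1 v] assms False van
      rho_diff[OF sl3_arith(4) E_in_sl3[of a l]]
    by (simp add: rho_zero matrix_vector_mult_uminus)
  moreover have "zsum (-2 *\<^sub>R eps 1)" by (intro zsum_arith zsum_eps)
  ultimately have "?y = 0"
    using weight_lower[of l 1, OF _ y] assms by (auto simp: eps_nth)
  then show ?thesis using assms by (simp add: \<kappa>_def)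
qed

lemma rho_\<kappa>:
  assumes X: "X \<in> sl3" and v: "v \<in> K"
  shows "rho X *v \<kappa> a v = (\<Sum>l\<in>UNIV. X $ l $ a *\<^sub>R \<kappa> l v)"
proof -
  have vw: "weight_vector (eps 1) v" using v by (simp add: K_def)
  have 1: "rho Y *v v = (\<Sum>l\<in>UNIV. Y $ l $ 1 *\<^sub>R \<kappa> l v)" if Y: "Y \<in> sl3" for Y
  proof -
    have tr: "Y $ 1 $ 1 + Y $ 2 $ 2 + Y $ 3 $ 3 = 0"
      using Y by (simp add: sl3_def trace_def sum_3)
    have "e 1 b v = 0" if "b \<noteq> 1" for b
      using that by (intro E_kills[OF _ vw zsum_eps]) (auto simp: eps_nth)
    moreover have "eps 1 $ 1 * Y $ 1 $ 1 + eps 1 $ 2 * Y $ 2 $ 2 + eps 1 $ 3 * Y $ 3 $ 3 = Y $ 1 $ 1"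
      using tr by (simp add: eps_nth)
    ultimately show ?thesis
      using v unfolding rho_expand[OF Y vw] by (simp add: sum_3 \<kappa>_def K_def)
  qed
  show ?thesis
  proof (cases "a = 1")
    case True
    then show ?thesis using 1[OF X] by (simp add: \<kappa>_def)
  next
    case False
    let ?B = "X ** E a 1 - E a 1 ** X"
    have "rho X *v \<kappa> a v = rho X *v e a 1 v" using False by (simp add: \<kappa>_def)
    also have "\<dots> = e a 1 (rho X *v v) + rho ?B *v v"
      using False by (intro rho_bracket X E_in_sl3)
    also have "\<dots> = (\<Sum>l\<in>UNIV. X $ l $ 1 *\<^sub>R e a 1 (\<kappa> l v)) + (\<Sum>l\<in>UNIV. ?B $ l $ 1 *\<^sub>R \<kappa> l v)"
      unfolding 1[OF X] 1[OF commutator_in_sl3] by (simp add: sum_3 lin)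
    also have "(\<Sum>l\<in>UNIV. X $ l $ 1 *\<^sub>R e a 1 (\<kappa> l v)) = X $ 1 $ 1 *\<^sub>R \<kappa> a v"
      using False by (simp add: sum_3 e_\<kappa>_zero[OF v]) (simp add: \<kappa>_def)
    finally show ?thesis
      using False exhaust_3[of a]
      by (elim disjE) (simp_all add: sum_3 mult_E_component algebra_simps)
  qed
qed

text \<open>The operators \<open>E a b\<close> would produce a vector whose weight is a root; a root
  has a coordinate 1, so it is not a weight.\<close>

lemma rho_zero_weight:
  assumes "X \<in> sl3" "weight_vector 0 v"
  shows "rho X *v v = 0"
proof -
  have "e a b v = 0" if "a \<noteq> b" for a b
    using that assms by (intro E_kills[of a b 0]) (auto simp: zsum_def)
  then show ?thesis using rho_expand[OF assms] by simp
qed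

end

section \<open>The isomorphism with the model\<close>

context sym_type_representation
begin

lemma transpose_E: "transpose (E i j) = E j i"
  by (simp add: transpose_def E_def vec_eq_iff conj_commute)

text \<open>The inverse of the sought isomorphism, for families \<open>b\<close> in \<open>K\<close> and \<open>c\<close> in the zero weight space.\<close>
definition \<psi> :: "nat \<Rightarrow> nat \<Rightarrow> (nat \<Rightarrow> real^'n) \<Rightarrow> (nat \<Rightarrow> real^'n) \<Rightarrow> model \<Rightarrow> real^'n" where
  "\<psi> k m b c x = (\<Sum>i\<in>UNIV. \<Sum>j\<in>UNIV. fst x $ i $ j *\<^sub>R q i j)
    + (\<Sum>i<k. \<Sum>a\<in>UNIV. fst (snd x) i $ a *\<^sub>R \<kappa> a (b i)) + (\<Sum>j<m. snd (snd x) j *\<^sub>R c j)"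

lemma \<psi>_equivariant:
  assumes X: "X \<in> sl3" and b: "\<And>i. i < k \<Longrightarrow> b i \<in> K" and c: "\<And>j. j < m \<Longrightarrow> weight_vector 0 (c j)"
  shows "rho X *v \<psi> k m b c x = \<psi> k m b c (model_act X x)"
proof -
  obtain S v t where x: "x = (S, v, t)" by (cases x)
  have lin: "linear ((*v) (rho X))" by simp
  note simps = linear_add[OF lin] linear_sum[OF lin] linear_scale[OF lin]
  have 1: "(\<Sum>i\<in>UNIV. \<Sum>j\<in>UNIV. S $ i $ j *\<^sub>R (rho X *v q i j))
    = (\<Sum>i\<in>UNIV. \<Sum>j\<in>UNIV. (- (transpose X ** S + S ** X)) $ i $ j *\<^sub>R q i j)"
    by (simp add: rho_q[OF X] sum_3 matrix_matrix_mult_def transpose_def vec_eq_iff algebra_simps)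
  have 2: "(\<Sum>a\<in>UNIV. v i $ a *\<^sub>R (rho X *v \<kappa> a (b i))) = (\<Sum>a\<in>UNIV. (X *v v i) $ a *\<^sub>R \<kappa> a (b i))"
    if "i < k" for i
    unfolding rho_\<kappa>[OF X b[OF that]]
    by (simp add: sum_3 matrix_vector_mult_def[of X] vec_eq_iff algebra_simps)
  show ?thesis
    by (simp add: x \<psi>_def simps model_act_def 1 2 rho_zero_weight[OF X c])
qed

lemma \<psi>_linear:
  "\<psi> k m b c (S + S', (\<lambda>i. v i + v' i), (\<lambda>j. t j + t' j)) = \<psi> k m b c (S, v, t) + \<psi> k m b c (S', v', t')"
  "\<psi> k m b c (r *\<^sub>R S, (\<lambda>i. r *\<^sub>R v i), (\<lambda>j. r * t j)) = r *\<^sub>R \<psi> k m b c (S, v, t)"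
  by (simp_all add: \<psi>_def scaleR_add_left sum.distrib scaleR_right.sum scaleR_add_right)

section \<open>Separating the constituents inside each weight space\<close>

lemma e_q_pair:
  assumes "a \<noteq> b"
  shows "e a b (q a b) = - q b b"
  using assms exhaust_3[of a] exhaust_3[of b] unfolding rho_q[OF E_in_sl3[OF assms]]
  by (elim disjE) (simp_all add: sum_3 E_def)

lemma e_\<kappa>_other:
  assumes "v \<in> K" "a \<noteq> b" "c \<noteq> b"
  shows "e a b (\<kappa> c v) = 0"
  using assms unfolding rho_\<kappa>[OF E_in_sl3[OF assms(2)] assms(1)] by (simp add: E_def)

lemma \<kappa>_eq_zero:
  assumes "v \<in> K" "\<kappa> a v = 0"
  shows "v = 0"
proof (cases "a = 1")
  case False
  have "e 1 a (\<kappa> a v) = \<kappa> 1 v"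
    using False unfolding rho_\<kappa>[OF E_in_sl3[OF False[symmetric]] assms(1)]
    by (simp add: E_def if_distrib[of "\<lambda>x. x *\<^sub>R _"] cong: if_cong)
  then show ?thesis using assms(2) by (simp add: \<kappa>_def)
qed (use assms in \<open>simp add: \<kappa>_def\<close>)

text \<open>The element \<open>diag (1, 2, -3)\<close> takes different values on all weights that occur.\<close>
lemma weight_vectors_independent:
  assumes x: "\<And>a. weight_vector (-2 *\<^sub>R eps a) (x a)" and y: "\<And>a. weight_vector (eps a) (y a)"
    and z: "weight_vector 0 z"
    and sum: "(\<Sum>a\<in>UNIV. x a) + (\<Sum>a\<in>UNIV. y a) + z = 0"
  shows "x a = 0 \<and> y a = 0 \<and> z = 0"
proof -
  define \<tau> :: "real^3" where "\<tau> = vector [1, 2, -3]"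
  let ?T = "(*v) (rho (D \<tau>))"
  have \<tau>: "zsum \<tau>" by (simp add: zsum_def \<tau>_def)
  have dot: "eps a \<bullet> \<tau> = \<tau> $ a" for a using inner_eps[OF \<tau>] by (simp add: inner_commute)
  have T: "?T (x a) = (-2 * \<tau> $ a) *\<^sub>R x a" "?T (y a) = \<tau> $ a *\<^sub>R y a" "?T z = 0" for a
    using weight_vectorD[OF x \<tau>] weight_vectorD[OF y \<tau>] weight_vectorD[OF z \<tau>] by (simp_all add: dot)
  have \<tau>n: "\<tau> $ 1 = 1" "\<tau> $ 2 = 2" "\<tau> $ 3 = -3" by (simp_all add: \<tau>_def)
  define f where "f s = (if s = -2 then x 1 else if s = -4 then x 2 else if s = 6 then x 3
    else if s = 1 then y 1 else if s = 2 then y 2 else if s = -3 then y 3 else z)" for s :: real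
  let ?S = "{-2, -4, 6, 1, 2, -3, 0} :: real set"
  have lin: "linear ?T" by simp
  have Tf: "?T (f s) = s *\<^sub>R f s" if "s \<in> ?S" for s
    using that T(1)[of 1] T(1)[of 2] T(1)[of 3] T(2)[of 1] T(2)[of 2] T(2)[of 3] T(3) by (elim insertE emptyE) (simp_all add: f_def \<tau>n)
  have "(\<Sum>s\<in>?S. f s) = (\<Sum>a\<in>UNIV. x a) + (\<Sum>a\<in>UNIV. y a) + z"
    by (simp add: f_def sum_3)
  then have f0: "f s = 0" if "s \<in> ?S" for s
    using eigencomponents_zero[OF lin _ Tf _ that] sum by simp
  have "x 1 = 0" "x 2 = 0" "x 3 = 0" "y 1 = 0" "y 2 = 0" "y 3 = 0" "z = 0"
    using f0[of "-2"] f0[of "-4"] f0[of 6] f0[of 1] f0[of 2] f0[of "-3"] f0[of 0] by (simp_all add: f_def)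
  then show ?thesis using exhaust_3[of a] by auto
qed

lemma weight_vector_sum:
  "(\<And>i. i \<in> I \<Longrightarrow> weight_vector x (f i)) \<Longrightarrow> weight_vector x (\<Sum>i\<in>I. f i)"
  by (simp add: weight_vector_def linear_sum[OF matrix_vector_mul_linear] scaleR_right.sum)

lemma weight_vector_add: "weight_vector x v \<Longrightarrow> weight_vector x w \<Longrightarrow> weight_vector x (v + w)"
  by (simp add: weight_vector_def lin scaleR_add_right)

text \<open>Sorting the sum by weights isolates the diagonal of \<open>S\<close> and the trivial
  part. Weight \<open>eps a\<close> mixes an off-diagonal entry of \<open>S\<close> with the copies
  of E, and \<open>E i j\<close> tells these apart.\<close>

lemma \<psi>_zero_imp:
  assumes S: "transpose S = S"
    and b: "\<And>i. i < k \<Longrightarrow> b i \<in> K" "\<And>r. (\<Sum>i<k. r i *\<^sub>R b i) = 0 \<Longrightarrow> \<forall>i<k. r i = 0"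
    and c: "\<And>j. j < m \<Longrightarrow> weight_vector 0 (c j)" "\<And>r. (\<Sum>j<m. r j *\<^sub>R c j) = 0 \<Longrightarrow> \<forall>j<m. r j = 0"
    and zero: "\<psi> k m b c (S, v, t) = 0"
  shows "S = 0" "i < k \<Longrightarrow> v i = 0" "j < m \<Longrightarrow> t j = 0"
proof -
  define B where "B a = (\<Sum>i<k. v i $ a *\<^sub>R b i)" for a
  have BK: "B a \<in> K" for a
    unfolding B_def using b(1) by (intro subspace_sum subspace_scale subspace_K) auto
  have Sij: "S $ i $ j = S $ j $ i" for i j using S by (simp add: transpose_def vec_eq_iff)
  \<comment> \<open>Of the off-diagonal entries only those avoiding \<open>a\<close> have weight
    \<open>eps a\<close>. Ordered pairs are summed, whence the factor 2 in the next fact.\<close>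
  define Q where "Q a = (\<Sum>i\<in>UNIV. \<Sum>j\<in>UNIV. (if i \<noteq> j \<and> i \<noteq> a \<and> j \<noteq> a then S $ i $ j else 0) *\<^sub>R q i j)" for a
  have Q: "Q a = (2 * S $ i $ j) *\<^sub>R q i j" if "a \<noteq> i" "a \<noteq> j" "i \<noteq> j" for a i j
    unfolding Q_def sum_3
    using that exhaust_3[of a] exhaust_3[of i] exhaust_3[of j]
    by (elim disjE) (simp_all add: Sij[of 2 1] Sij[of 3 1] Sij[of 3 2] q_sym[of 2 1] q_sym[of 3 1] q_sym[of 3 2] vec_eq_iff)
  have wQ: "weight_vector (eps a) (Q a)" for a
  proof -
    obtain i j where d: "a \<noteq> i" "a \<noteq> j" "i \<noteq> j" by (rule other_indices)
    have "- eps i - eps j = eps a" by (auto simp: vec_eq_distinct[OF d] eps_nth d d[symmetric])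
    then show ?thesis unfolding Q[OF d] using weight_vector_q[of i j] by (simp add: weight_vector_scale)
  qed
  have kB: "(\<Sum>i<k. \<Sum>a\<in>UNIV. v i $ a *\<^sub>R \<kappa> a (b i)) = (\<Sum>a\<in>UNIV. \<kappa> a (B a))"
    unfolding B_def linear_sum[OF linear_\<kappa>] linear_scale[OF linear_\<kappa>] by (rule sum.swap)
  have "\<psi> k m b c (S, v, t) = (\<Sum>a\<in>UNIV. S $ a $ a *\<^sub>R q a a) + (\<Sum>a\<in>UNIV. Q a + \<kappa> a (B a)) + (\<Sum>j<m. t j *\<^sub>R c j)"
    by (simp add: \<psi>_def kB sum.distrib) (simp add: sum_3 Q_def)
  then have sum0: "(\<Sum>a\<in>UNIV. S $ a $ a *\<^sub>R q a a) + (\<Sum>a\<in>UNIV. Q a + \<kappa> a (B a)) + (\<Sum>j<m. t j *\<^sub>R c j) = 0"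
    using zero by simp
  have "weight_vector (-2 *\<^sub>R eps a) (q a a)" for a
    using weight_vector_q[of a a] by (simp add: scaleR_2)
  then have wx: "weight_vector (-2 *\<^sub>R eps a) (S $ a $ a *\<^sub>R q a a)" for a by (rule weight_vector_scale)
  have wy: "weight_vector (eps a) (Q a + \<kappa> a (B a))" for a
    by (intro weight_vector_add wQ weight_vector_\<kappa> BK)
  have wz: "weight_vector 0 (\<Sum>j<m. t j *\<^sub>R c j)"
    using c(1) by (intro weight_vector_sum weight_vector_scale) auto
  have comp: "S $ a $ a *\<^sub>R q a a = 0" "Q a + \<kappa> a (B a) = 0" "(\<Sum>j<m. t j *\<^sub>R c j) = 0" for a
    using weight_vectors_independent[OF wx wy wz sum0, of a] by auto
  have offdiag: "S $ i $ j = 0" "B a = 0" if d: "a \<noteq> i" "a \<noteq> j" "i \<noteq> j" for a i j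
  proof -
    \<comment> \<open>Here \<open>E i j\<close> kills the \<kappa> part and sends
      \<open>q i j\<close> to the nonzero vector \<open>- q j j\<close>.\<close>
    have "e i j (Q a + \<kappa> a (B a)) = - ((2 * S $ i $ j) *\<^sub>R q j j)"
      using d by (simp add: Q[OF d] lin e_q_pair e_\<kappa>_other[OF BK])
    then show *: "S $ i $ j = 0" using q_nonzero[of j] by (simp add: comp)
    then show "B a = 0" using comp(2)[of a] \<kappa>_eq_zero[OF BK] by (simp add: Q[OF d])
  qed
  show "S = 0"
    unfolding vec_eq_iff forall_3
    using comp(1) q_nonzero offdiag(1)[of 3 1 2] offdiag(1)[of 2 1 3] offdiag(1)[of 1 2 3]
    by (simp add: Sij[of 2 1] Sij[of 3 1] Sij[of 3 2])
  have B0: "B a = 0" for a using other_indices[of a] offdiag(2) by metis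
  show "v i = 0" if "i < k" for i
    using b(2)[of "\<lambda>i. v i $ a" for a] B0 that by (simp add: B_def vec_eq_iff)
  show "t j = 0" if "j < m" for j using c(2)[OF comp(3)] that by blast
qed

text \<open>The vector \<open>e i j v\<close> has weight \<open>-2 eps j\<close>, so multiplicity
  one makes it a multiple of \<open>q j j\<close>. A multiple of \<open>q i j\<close> cancels it,
  and a remainder killed by \<open>e i j\<close> belongs to a copy of E.\<close>

lemma weight_eps_decomposition:
  assumes v: "weight_vector (eps a) v"
  obtains s i j w where "w \<in> K" "v = s *\<^sub>R q i j + \<kappa> a w"
proof -
  \<comment> \<open>For \<open>a \<noteq> 1\<close> the choice \<open>i = 1\<close> makes
    \<open>e i j\<close> the operator that arises below, up to sign, as the commutator of
    \<open>e a j\<close> and \<open>e 1 a\<close>.\<close>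
  obtain i j where d: "a \<noteq> i" "a \<noteq> j" "i \<noteq> j" and i1: "a \<noteq> 1 \<Longrightarrow> i = 1"
  proof (cases "a = 1")
    case True
    then show thesis using that[of 2 3] by simp
  next
    case False
    then show thesis using exhaust_3[of a] that[of 1 2] that[of 1 3] by auto
  qed
  have wq: "- eps i - eps j = eps a" by (auto simp: vec_eq_distinct[OF d] eps_nth d d[symmetric])
  have "weight_vector (eps a + rootvec i j) (e i j v)" using d(3) v by (rule weight_vector_E)
  moreover have "eps a + rootvec i j = -2 *\<^sub>R eps j"
    by (auto simp: vec_eq_distinct[OF d] eps_nth root_nth d d[symmetric])
  ultimately have "weight_vector (-2 *\<^sub>R eps j) (e i j v)" by simp
  moreover have "weight_vector (-2 *\<^sub>R eps j) (q j j)" using weight_vector_q[of j j] by (simp add: scaleR_2)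
  ultimately obtain s where s: "e i j v = s *\<^sub>R q j j" using multiplicity_one q_nonzero by blast
  define v' where "v' = v + s *\<^sub>R q i j"
  have v': "weight_vector (eps a) v'"
    unfolding v'_def using v weight_vector_q[of i j] by (intro weight_vector_add weight_vector_scale) (simp_all add: wq)
  have ev': "e i j v' = 0" using d(3) by (simp add: v'_def lin s e_q_pair)
  have "\<exists>w\<in>K. v' = \<kappa> a w"
  proof (cases "a = 1")
    case True
    then have "v' \<in> K" using v' ev' d by (intro K_intro[of v' i j]) auto
    then show ?thesis using True by (auto simp: \<kappa>_def)
  next
    case False
    then have i: "i = 1" using i1 by simp
    \<comment> \<open>In a copy of E the operator \<open>e 1 a\<close> inverts
      \<open>\<kappa> a\<close>.\<close>
    let ?w = "e 1 a v'"
    have kills: "e a l v' = 0" if "l \<noteq> a" for l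
      using that by (intro E_kills[OF _ v' zsum_eps]) (auto simp: eps_nth)
    have ww: "weight_vector (eps 1) ?w"
      using weight_vector_E[of 1 a, OF _ v'] False by (simp add: rootvec_eps)
    have "e a j ?w = 0"
      using E_commute[of a j 1 a v'] kills[of j] ev' d False i
        rho_diff[OF sl3_arith(4) E_in_sl3[of 1 j]]
      by (simp add: rho_zero matrix_vector_mult_uminus)
    then have "?w \<in> K" using ww d i by (intro K_intro[of ?w a j]) auto
    moreover have "e a 1 ?w = v'"
      using E_commute[of a 1 1 a v'] kills[of 1] weight_vector_root[OF v', of a 1] False
      by (simp add: E_diff_eq_D eps_nth)
    ultimately show ?thesis using False by (intro bexI[of _ ?w]) (simp_all add: \<kappa>_def)
  qed
  then obtain w where "w \<in> K" "v' = \<kappa> a w" by blast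
  then show thesis using that[of w "- s" i j] by (simp add: v'_def algebra_simps)
qed

text \<open>Injectivity of \<psi> is \<open>\<psi>_zero_imp\<close>; its image is a subspace that
  contains all weight vectors, hence everything. The isomorphism is its inverse.\<close>

lemma isomorphic_to_model: "\<exists>k m. rep_iso rho model_act (model_carrier k m)"
proof -
  obtain k :: nat and b where b: "\<And>i. i < k \<Longrightarrow> b i \<in> K"
    "\<And>v. v \<in> K \<Longrightarrow> \<exists>r. (\<forall>i\<ge>k. r i = 0) \<and> v = (\<Sum>i<k. r i *\<^sub>R b i)"
    "\<And>r. (\<Sum>i<k. r i *\<^sub>R b i) = 0 \<Longrightarrow> \<forall>i<k. r i = 0"
    using subspace_K by (rule subspace_indexed_basis) blast
  have "subspace {v. weight_vector 0 v}"
    by (auto simp: subspace_def weight_vector_def lin)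
  then obtain m :: nat and c where "\<And>j. j < m \<Longrightarrow> c j \<in> {v. weight_vector 0 v}"
    "\<And>v. v \<in> {v. weight_vector 0 v} \<Longrightarrow> \<exists>r. (\<forall>j\<ge>m. r j = 0) \<and> v = (\<Sum>j<m. r j *\<^sub>R c j)"
    "\<And>r. (\<Sum>j<m. r j *\<^sub>R c j) = 0 \<Longrightarrow> \<forall>j<m. r j = 0"
    by (rule subspace_indexed_basis) blast
  then have c: "\<And>j. j < m \<Longrightarrow> weight_vector 0 (c j)"
    "\<And>v. weight_vector 0 v \<Longrightarrow> \<exists>r. (\<forall>j\<ge>m. r j = 0) \<and> v = (\<Sum>j<m. r j *\<^sub>R c j)"
    "\<And>r. (\<Sum>j<m. r j *\<^sub>R c j) = 0 \<Longrightarrow> \<forall>j<m. r j = 0"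
    by blast+
  let ?M = "model_carrier k m" and ?\<psi> = "\<psi> k m b c"
  have add: "(S + S', (\<lambda>i. v i + v' i), (\<lambda>j. t j + t' j)) \<in> ?M"
    if "(S, v, t) \<in> ?M" "(S', v', t') \<in> ?M" for S S' v v' t t'
    using that by (auto simp: model_carrier_def transpose_def vec_eq_iff)
  have scale: "(r *\<^sub>R S, (\<lambda>i. r *\<^sub>R v i), (\<lambda>j. r * t j)) \<in> ?M" if "(S, v, t) \<in> ?M" for r S v t
    using that by (auto simp: model_carrier_def transpose_def vec_eq_iff)
  have inj: "inj_on ?\<psi> ?M"
  proof (rule inj_onI)
    fix x y assume "x \<in> ?M" "y \<in> ?M" "?\<psi> x = ?\<psi> y"
    moreover obtain S v t S' v' t' where xy: "x = (S, v, t)" "y = (S', v', t')" by (metis prod.collapse)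
    ultimately have M: "(S, v, t) \<in> ?M" "(S', v', t') \<in> ?M" and eq: "?\<psi> (S, v, t) = ?\<psi> (S', v', t')" by auto
    \<comment> \<open>The difference of the two triples, written with the multiple by -1 so that
      both parts of \<open>\<psi>_linear\<close> apply.\<close>
    let ?d = "(S + (-1) *\<^sub>R S', (\<lambda>i. v i + (-1) *\<^sub>R v' i), (\<lambda>j. t j + (-1) * t' j))"
    have d: "?\<psi> ?d = 0" unfolding \<psi>_linear eq by simp
    have "?d \<in> ?M" by (intro add scale M)
    then have "transpose (S + (-1) *\<^sub>R S') = S + (-1) *\<^sub>R S'" by (simp add: model_carrier_def)
    note z = \<psi>_zero_imp[OF this b(1,3) c(1,3) d]
    have "S = S'" using z(1) by simp
    moreover have "v i = v' i" for i
      using z(2)[of i] M by (cases "i < k") (auto simp: model_carrier_def)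
    moreover have "t j = t' j" for j
      using z(3)[of j] M by (cases "j < m") (auto simp: model_carrier_def)
    ultimately show "x = y" by (auto simp: xy)
  qed
  have R: "subspace (?\<psi> ` ?M)"
    unfolding subspace_def
  proof (intro conjI ballI allI)
    show "0 \<in> ?\<psi> ` ?M"
      by (intro image_eqI[of _ _ "(0, \<lambda>_. 0, \<lambda>_. 0)"]) (simp_all add: \<psi>_def model_carrier_def transpose_def vec_eq_iff)
    show "x + y \<in> ?\<psi> ` ?M" if "x \<in> ?\<psi> ` ?M" "y \<in> ?\<psi> ` ?M" for x y
      using that add by (force simp flip: \<psi>_linear(1))
    show "r *\<^sub>R x \<in> ?\<psi> ` ?M" if "x \<in> ?\<psi> ` ?M" for r x
      using that scale by (force simp flip: \<psi>_linear(2))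
  qed
  have qR: "q i j \<in> ?\<psi> ` ?M" for i j
  proof (rule image_eqI)
    \<comment> \<open>The matrix unit has to be symmetrized to lie in the carrier;
      \<open>q_sym\<close> merges the two halves.\<close>
    let ?x = "((1 / 2) *\<^sub>R (E i j + E j i), \<lambda>_. 0, \<lambda>_. 0) :: model"
    have "transpose ((1 / 2) *\<^sub>R (A + transpose A)) = (1 / 2) *\<^sub>R (A + transpose A)" for A :: "real^3^3"
      by (simp add: transpose_def vec_eq_iff)
    from this[of "E i j"] show "?x \<in> ?M" by (simp add: model_carrier_def transpose_E)
    show "q i j = ?\<psi> ?x"
      using exhaust_3[of i] exhaust_3[of j]
      by (elim disjE) (simp_all add: \<psi>_def sum_3 E_def q_sym[of 2 1] q_sym[of 3 1] q_sym[of 3 2] vec_eq_iff)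
  qed
  have \<kappa>R: "\<kappa> a w \<in> ?\<psi> ` ?M" if w: "w \<in> K" for a w
  proof -
    obtain r where r: "\<forall>i\<ge>k. r i = 0" "w = (\<Sum>i<k. r i *\<^sub>R b i)" using b(2)[OF w] by blast
    let ?x = "(0, \<lambda>i. axis a (r i), \<lambda>_. 0) :: model"
    have M: "?x \<in> ?M" using r(1) by (auto simp: model_carrier_def transpose_def vec_eq_iff axis_def)
    have "(\<Sum>l\<in>UNIV. axis a (r i) $ l *\<^sub>R \<kappa> l (b i)) = r i *\<^sub>R \<kappa> a (b i)" for i
      by (simp add: axis_def if_distrib[of "\<lambda>x. x *\<^sub>R _"] cong: if_cong)
    then have "\<kappa> a w = ?\<psi> ?x"
      by (simp add: \<psi>_def r(2) linear_sum[OF linear_\<kappa>] linear_scale[OF linear_\<kappa>])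
    then show ?thesis using M by (rule image_eqI)
  qed
  have cR: "w \<in> ?\<psi> ` ?M" if w: "weight_vector 0 w" for w
  proof -
    obtain r where r: "\<forall>j\<ge>m. r j = 0" "w = (\<Sum>j<m. r j *\<^sub>R c j)" using c(2)[OF w] by blast
    let ?x = "(0, \<lambda>_. 0, r) :: model"
    have M: "?x \<in> ?M" using r(1) by (auto simp: model_carrier_def transpose_def vec_eq_iff)
    have "w = ?\<psi> ?x" by (simp add: \<psi>_def r(2))
    then show ?thesis using M by (rule image_eqI)
  qed
  have "w \<in> ?\<psi> ` ?M" if x: "zsum x" "weight_vector x w" for x w
  proof (cases "w = 0")
    case True
    then show ?thesis using subspace_0[OF R] by simp
  next
    case False
    then have "x \<in> weights" using x by (auto simp: weights_def)
    then consider "x = 0" | a where "x = eps a" | a where "x = -2 *\<^sub>R eps a" using weight_cases by blast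
    then show ?thesis
    proof cases
      case 1
      then show ?thesis using x(2) cR by simp
    next
      case (2 a)
      then obtain s i j w' where "w' \<in> K" "w = s *\<^sub>R q i j + \<kappa> a w'"
        using weight_eps_decomposition[of a w] x(2) by metis
      then show ?thesis by (simp add: subspace_add[OF R subspace_scale[OF R qR] \<kappa>R])
    next
      case (3 a)
      have "weight_vector (-2 *\<^sub>R eps a) (q a a)" using weight_vector_q[of a a] by (simp add: scaleR_2)
      then obtain r where "w = r *\<^sub>R q a a" using multiplicity_one q_nonzero x(2) 3 by blast
      then show ?thesis using subspace_scale[OF R qR] by simp
    qed
  qed
  then have "span {v. \<exists>x. zsum x \<and> weight_vector x v} \<subseteq> ?\<psi> ` ?M"
    by (intro span_minimal R) blast
  then have surj: "?\<psi> ` ?M = UNIV" unfolding weight_spaces_span by blast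
  define \<phi> where "\<phi> = inv_into ?M ?\<psi>"
  have \<phi>M: "\<phi> w \<in> ?M" and \<psi>\<phi>: "?\<psi> (\<phi> w) = w" for w
    unfolding \<phi>_def using surj by (auto intro: inv_into_into f_inv_into_f)
  have \<phi>\<psi>: "\<phi> w = x" if "x \<in> ?M" "?\<psi> x = w" for x w
    unfolding \<phi>_def using inv_into_f_f[OF inj that(1)] that(2) by simp
  have \<phi>_add: "\<phi> (x + y) = (fst (\<phi> x) + fst (\<phi> y), (\<lambda>i. fst (snd (\<phi> x)) i + fst (snd (\<phi> y)) i),
      (\<lambda>j. snd (snd (\<phi> x)) j + snd (snd (\<phi> y)) j))" for x y
    using \<phi>M[of x] \<phi>M[of y] by (intro \<phi>\<psi> add) (simp_all add: \<psi>_linear \<psi>\<phi>)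
  have \<phi>_scale: "\<phi> (r *\<^sub>R x) = (r *\<^sub>R fst (\<phi> x), (\<lambda>i. r *\<^sub>R fst (snd (\<phi> x)) i),
      (\<lambda>j. r * snd (snd (\<phi> x)) j))" for r x
    using \<phi>M[of x] by (intro \<phi>\<psi> scale) (simp_all add: \<psi>_linear \<psi>\<phi>)
  have "linear_to_model \<phi>"
    unfolding linear_to_model_def by (intro conjI allI linearI) (simp_all add: \<phi>_add \<phi>_scale)
  moreover have "inj \<phi>" by (rule injI) (metis \<psi>\<phi>)
  moreover have "range \<phi> = ?M"
  proof (intro equalityI subsetI)
    show "x \<in> range \<phi>" if "x \<in> ?M" for x using \<phi>\<psi>[OF that refl] by (metis rangeI)
  qed (use \<phi>M in blast)
  moreover have "\<phi> (rho X *v w) = model_act X (\<phi> w)" if X: "X \<in> sl3" for X w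
  proof (rule \<phi>\<psi>)
    obtain S v t where x: "\<phi> w = (S, v, t)" by (cases "\<phi> w")
    have "(S, v, t) \<in> ?M" using \<phi>M[of w] x by simp
    moreover have "transpose (- (transpose X ** S + S ** X)) = - (transpose X ** S + S ** X)"
      if S: "transpose S = S"
    proof -
      have "transpose (transpose X ** S + S ** X) = transpose (transpose X ** S) + transpose (S ** X)"
        by (simp add: transpose_def vec_eq_iff)
      then have sym: "transpose (transpose X ** S + S ** X) = transpose X ** S + S ** X"
        using S by (simp add: matrix_transpose_mul add.commute)
      have "transpose (- A) = - transpose A" for A :: "real^3^3"
        by (simp add: transpose_def vec_eq_iff)
      then show ?thesis by (simp only: sym)
    qed
    ultimately show "model_act X (\<phi> w) \<in> ?M"
      by (simp add: x model_act_def model_carrier_def)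
    show "?\<psi> (model_act X (\<phi> w)) = rho X *v w"
      using \<psi>_equivariant[of X k b m c "\<phi> w", OF X b(1) c(1)] by (simp add: \<psi>\<phi>)
  qed
  ultimately show ?thesis unfolding rep_iso_def by blast
qed

end

context wedge_representation
begin

section \<open>The two signs of the longest weight\<close>

lemma isomorphic_to_model_if_longest_negative:
  assumes x: "longest x" and "i \<noteq> j" "i \<noteq> k" "j \<noteq> k" "s > 0" "x $ i = -2 * s" "x $ j = s" "x $ k = s"
  shows "\<exists>k m. rep_iso rho model_act (model_carrier k m)"
proof -
  have xi: "x = -2 *\<^sub>R eps i" using assms by (rule longest_is_minus_two_eps)
  note cls = weights_classification[OF x xi]
  have four: "-2 *\<^sub>R -2 *\<^sub>R eps a \<notin> weights" for a
  proof
    assume w: "-2 *\<^sub>R -2 *\<^sub>R eps a \<in> weights"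
    show False using longestD(4)[OF x w] by (simp add: xi eps_inner_eps)
  qed
  obtain u where u: "u \<noteq> 0" "weight_vector (-2 *\<^sub>R eps 1) u"
    using cls(1)[of 1] by (auto simp: weights_def)
  interpret sym_type_representation rho u
  proof
    show "\<exists>c. v' = c *\<^sub>R v" if "weight_vector (-2 *\<^sub>R eps a) v" "weight_vector (-2 *\<^sub>R eps a) v'" "v \<noteq> 0"
      for a v v'
      using weight_multiplicity_one[OF that(1,2) _ that(3) four] zsum_arith(3)[OF zsum_eps] by metis
  qed (use cls(2) u in auto)
  show ?thesis by (rule isomorphic_to_model)
qed

text \<open>The map \<open>X \<mapsto> - transpose X\<close> is an automorphism of
  \<open>sl3\<close>, and the conditions on \<open>rho\<close> range over all of \<open>sl3\<close>,
  so they persist with the same \<open>wedge\<close>.\<close>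

lemma wedge_representation_dual: "wedge_representation (\<lambda>X. rho (- transpose X)) wedge"
proof -
  have sl: "- transpose X \<in> sl3" if "X \<in> sl3" for X
    using that by (simp add: sl3_def trace_def transpose_def sum_negf)
  have lin: "- transpose (a *\<^sub>R X + b *\<^sub>R Y) = a *\<^sub>R (- transpose X) + b *\<^sub>R (- transpose Y)"
    for a b and X Y :: "real^3^3"
    by (simp add: transpose_def vec_eq_iff)
  have bracket: "- transpose (X ** Y - Y ** X)
      = (- transpose X) ** (- transpose Y) - (- transpose Y) ** (- transpose X)" for X Y :: "real^3^3"
    by (simp add: transpose_def vec_eq_iff matrix_matrix_mult_def mult.commute)
  show ?thesis
  proof
    show "sl3_rep (\<lambda>X. rho (- transpose X))"
      using rep sl unfolding sl3_rep_def lin bracket by blast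
    show "Defs.faithful (\<lambda>X. rho (- transpose X))"
      unfolding faithful_def
    proof (intro ballI impI)
      fix X Y assume "X \<in> sl3" "Y \<in> sl3" "rho (- transpose X) = rho (- transpose Y)"
      then have "- transpose X = - transpose Y" using faithful sl unfolding faithful_def by blast
      then show "X = Y" by (metis neg_equal_iff_equal transpose_transpose)
    qed
    show "equivariant_wedge (\<lambda>X. rho (- transpose X)) wedge"
      using equivariant sl unfolding equivariant_wedge_def by blast
  qed (rule nonvanishing)
qed

text \<open>The automorphism sends \<open>D t\<close> to \<open>D (- t)\<close>, so it negates all
  weights and preserves lengths.\<close>

lemma longest_dual:
  assumes x: "longest x"
  shows "wedge_representation.longest (\<lambda>X. rho (- transpose X)) (- x)"
proof -
  interpret dual: wedge_representation "\<lambda>X. rho (- transpose X)" wedge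
    by (rule wedge_representation_dual)
  have Dt: "- transpose (D t) = D (- t)" for t
    by (simp add: D_def transpose_def vec_eq_iff)
  have "dual.weight_vector y v \<longleftrightarrow> weight_vector (- y) v" for y v
    unfolding dual.weight_vector_def weight_vector_def Dt
    by (metis (no_types, opaque_lifting) inner_minus_left inner_minus_right minus_minus zsum_arith(4))
  then have w: "y \<in> dual.weights \<longleftrightarrow> - y \<in> weights" for y
    unfolding dual.weights_def weights_def using zsum_arith(4)[of y] zsum_arith(4)[of "- y"] by auto
  show ?thesis
    using x bspec[of weights "\<lambda>y. y \<bullet> y \<le> x \<bullet> x" "- y" for y]
    by (auto simp: dual.longest_def longest_def w)
qed

end

theorem mainTheorem15:
  fixes rho :: "real^3^3 \<Rightarrow> real^'n^'n"
    and wedge :: "real^'n \<Rightarrow> real^'n \<Rightarrow> (real^'n \<Rightarrow> real)"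
  assumes "sl3_rep rho"
    and "faithful rho"
    and "equivariant_wedge rho wedge"
    and "\<forall>U. subspace U \<and> dim U = 2 \<longrightarrow> (\<exists>a\<in>U. \<exists>b\<in>U. wedge a b \<noteq> (\<lambda>c. 0))"
  shows "\<exists>k m::nat. rep_iso rho model_act (model_carrier k m) \<or>
                   rep_iso rho dual_model_act (model_carrier k m)"
proof -
  interpret wedge_representation rho wedge
    using assms by unfold_locales
  interpret dual: wedge_representation "\<lambda>X. rho (- transpose X)" wedge
    by (rule wedge_representation_dual)
  obtain x where x: "longest x" using longest_exists by blast
  then obtain i j k s where d: "i \<noteq> j" "i \<noteq> k" "j \<noteq> k" and s: "s \<noteq> 0" "x $ i = -2 * s" "x $ j = s" "x $ k = s"
    by (rule longest_shape)
  show ?thesis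
  proof (cases "s > 0")
    case True
    then show ?thesis using isomorphic_to_model_if_longest_negative[OF x d] s by blast
  next
    case False
    have "\<exists>k m. rep_iso (\<lambda>X. rho (- transpose X)) model_act (model_carrier k m)"
      using False s
      by (intro dual.isomorphic_to_model_if_longest_negative[OF longest_dual[OF x] d, of "- s"]) auto
    then obtain k m \<phi> where \<phi>: "linear_to_model \<phi>" "inj \<phi>" "range \<phi> = model_carrier k m"
      "\<And>X w. X \<in> sl3 \<Longrightarrow> \<phi> (rho (- transpose X) *v w) = model_act X (\<phi> w)"
      unfolding rep_iso_def by blast
    \<comment> \<open>The same \<phi> serves, because the action of \<open>- transpose X\<close> on
      the model is the dual action of \<open>X\<close>.\<close>
    have "\<phi> (rho X *v w) = dual_model_act X (\<phi> w)" if X: "X \<in> sl3" for X w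
    proof -
      have "- transpose X \<in> sl3" using X by (simp add: sl3_def trace_def transpose_def sum_negf)
      moreover have "- transpose (- transpose X) = X" by (simp add: transpose_def vec_eq_iff)
      moreover have "transpose (- transpose X) = - X" by (simp add: transpose_def vec_eq_iff)
      then have "model_act (- transpose X) y = dual_model_act X y" for y
        by (simp add: model_act_def dual_model_act_def matrix_vector_mult_uminus matrix_mult_uminus split: prod.split)
      ultimately show ?thesis using \<phi>(4)[of "- transpose X" w] by simp
    qed
    with \<phi>(1-3) show ?thesis unfolding rep_iso_def by blast
  qed
qed

end
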